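(* Let $\Gamma$ be a non-elementary word hyperbolic group. Then $\Gamma$ satisfies property $(P)$: for every finite subset $K \subseteq \Gamma$ there exists a tile $F$ of $\Gamma$ with $K \subseteq F$.
   Context: A tile in a countable group $\Gamma$ is a finite subset $F \subseteq \Gamma$ of cardinality at least two such that $\Gamma$ can be covered by non-overlapping left shifts of $F$; that is, there exists a subset $C \subseteq \Gamma$ (a center set) such that $\Gamma = \bigsqcup_{g \in C} gF$ (the sets $gF$, $g \in C$, are pairwise disjoint and their union is $\Gamma$). A countable group $\Gamma$ has property $(P)$ if for every finite subset $K$ of $\Gamma$ there is a tile of $\Gamma$ containing $K$. A finitely generated group is word hyperbolic if its Cayley graph with respect to some (equivalently, any) finite generating set is a $\delta$-hyperbolic geodesic metric space for some $\delta \ge 0$, i.e. in every geodesic triangle each side lies in the $\delta$-neighborhood of the union of the other two sides. Non-elementary has the standard meaning: the group is not virtually cyclic (in particular it is infinite). *)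

theory Defs
  imports "HOL-Analysis.Analysis" "HOL-Algebra.Algebra"
begin

definition tile :: "('a, 'b) monoid_scheme \<Rightarrow> 'a set \<Rightarrow> bool" where
  "tile G F \<longleftrightarrow> F \<subseteq> carrier G \<and> finite F \<and> card F \<ge> 2 \<and>
     (\<exists>C \<subseteq> carrier G. disjoint_family_on (\<lambda>g. g <#\<^bsub>G\<^esub> F) C \<and>
        (\<Union>g\<in>C. g <#\<^bsub>G\<^esub> F) = carrier G)"

text \<open>Countability is not built in: every finitely generated group is countable.\<close>

definition property_P :: "('a, 'b) monoid_scheme \<Rightarrow> bool" where
  "property_P G \<longleftrightarrow> (\<forall>K. finite K \<and> K \<subseteq> carrier G \<longrightarrow> (\<exists>F. tile G F \<and> K \<subseteq> F))"

definition geodesic_segment ::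
    "'p set \<Rightarrow> ('p \<Rightarrow> 'p \<Rightarrow> real) \<Rightarrow> 'p \<Rightarrow> 'p \<Rightarrow> 'p set \<Rightarrow> bool" where
  "geodesic_segment M d x y A \<longleftrightarrow>
     (\<exists>l\<ge>0. \<exists>f. f ` {0..l} \<subseteq> M \<and> f 0 = x \<and> f l = y \<and>
        (\<forall>s\<in>{0..l}. \<forall>t\<in>{0..l}. d (f s) (f t) = \<bar>s - t\<bar>) \<and> A = f ` {0..l})"

definition geodesic_metric_space :: "'p set \<Rightarrow> ('p \<Rightarrow> 'p \<Rightarrow> real) \<Rightarrow> bool" where
  "geodesic_metric_space M d \<longleftrightarrow> Metric_space M d \<and>
     (\<forall>x\<in>M. \<forall>y\<in>M. \<exists>A. geodesic_segment M d x y A)"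

definition neighborhood :: "'p set \<Rightarrow> ('p \<Rightarrow> 'p \<Rightarrow> real) \<Rightarrow> real \<Rightarrow> 'p set \<Rightarrow> 'p set" where
  "neighborhood M d \<delta> A = {p \<in> M. \<exists>q\<in>A. d p q \<le> \<delta>}"

definition hyperbolic_space :: "real \<Rightarrow> 'p set \<Rightarrow> ('p \<Rightarrow> 'p \<Rightarrow> real) \<Rightarrow> bool" where
  "hyperbolic_space \<delta> M d \<longleftrightarrow> geodesic_metric_space M d \<and>
     (\<forall>x\<in>M. \<forall>y\<in>M. \<forall>z\<in>M. \<forall>A B C.
        geodesic_segment M d x y A \<and> geodesic_segment M d y z B \<and> geodesic_segment M d z x C \<longrightarrow>
          A \<subseteq> neighborhood M d \<delta> (B \<union> C) \<and>
          B \<subseteq> neighborhood M d \<delta> (C \<union> A) \<and>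
          C \<subseteq> neighborhood M d \<delta> (A \<union> B))"

text \<open>
  A graph is given by a vertex set \<open>V\<close> and a symmetric irreflexive edge relation \<open>E\<close>. Its points
  are described by barycentric coordinates: the point of the edge \<open>{u, v}\<close> at distance \<open>t\<close> from
  \<open>u\<close> is the function taking the value \<open>1 - t\<close> at \<open>u\<close>, \<open>t\<close> at \<open>v\<close> and \<open>0\<close> elsewhere.
  The set \<open>closed_edge v v\<close> consists of the vertex \<open>v\<close> alone.
\<close>

definition closed_edge :: "'v \<Rightarrow> 'v \<Rightarrow> ('v \<Rightarrow> real) set" where
  "closed_edge u v = {x. (\<forall>w. 0 \<le> x w) \<and> {w. x w \<noteq> 0} \<subseteq> {u, v} \<and> sum x {u, v} = 1}"

definition graph_points :: "'v set \<Rightarrow> ('v \<times> 'v) set \<Rightarrow> ('v \<Rightarrow> real) set" where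
  "graph_points V E = (\<Union>v\<in>V. closed_edge v v) \<union> (\<Union>(u, v)\<in>E. closed_edge u v)"

definition edge_path_dist :: "('v \<times> 'v) set \<Rightarrow> 'v \<Rightarrow> 'v \<Rightarrow> nat" where
  "edge_path_dist E u v = (LEAST n. (u, v) \<in> E ^^ n)"

text \<open>
  The length metric in which every edge has length one. Two points of the closed edge \<open>{u, v}\<close>
  are at distance \<open>\<bar>x u - y u\<bar>\<close>, which is half of the \<open>\<ell>\<^sub>1\<close>-distance. For two points not on a
  common edge, a shortest path leaves the edge of \<open>x\<close> at an endpoint \<open>u\<close> and enters that of \<open>y\<close>
  at an endpoint \<open>v\<close>. The value off \<open>graph_points V E\<close> only serves the locale
  \<open>Metric_space\<close>, which demands symmetry and non-negativity everywhere.
\<close>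

definition graph_metric :: "'v set \<Rightarrow> ('v \<times> 'v) set \<Rightarrow> ('v \<Rightarrow> real) \<Rightarrow> ('v \<Rightarrow> real) \<Rightarrow> real" where
  "graph_metric V E x y =
     (if x \<notin> graph_points V E \<or> y \<notin> graph_points V E then 0
      else if x = y \<or> (\<exists>(u, v)\<in>E. x \<in> closed_edge u v \<and> y \<in> closed_edge u v)
        then (\<Sum>w\<in>{w. x w \<noteq> 0} \<union> {w. y w \<noteq> 0}. \<bar>x w - y w\<bar>) / 2
      else Min ((\<lambda>(u, v). (1 - x u) + real (edge_path_dist E u v) + (1 - y v)) `
                  ({u. x u \<noteq> 0} \<times> {v. y v \<noteq> 0})))"

text \<open>Loops (from \<open>\<one> \<in> S\<close>), multiple edges and orientations are dropped.\<close>

definition cayley_edges :: "('a, 'b) monoid_scheme \<Rightarrow> 'a set \<Rightarrow> ('a \<times> 'a) set" where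
  "cayley_edges G S = {(g, h). g \<in> carrier G \<and> h \<in> carrier G \<and> g \<noteq> h \<and>
     (\<exists>s\<in>S. h = g \<otimes>\<^bsub>G\<^esub> s \<or> g = h \<otimes>\<^bsub>G\<^esub> s)}"

abbreviation cayley_points :: "('a, 'b) monoid_scheme \<Rightarrow> 'a set \<Rightarrow> ('a \<Rightarrow> real) set" where
  "cayley_points G S \<equiv> graph_points (carrier G) (cayley_edges G S)"

abbreviation cayley_metric ::
    "('a, 'b) monoid_scheme \<Rightarrow> 'a set \<Rightarrow> ('a \<Rightarrow> real) \<Rightarrow> ('a \<Rightarrow> real) \<Rightarrow> real" where
  "cayley_metric G S \<equiv> graph_metric (carrier G) (cayley_edges G S)"

definition word_hyperbolic :: "('a, 'b) monoid_scheme \<Rightarrow> bool" where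
  "word_hyperbolic G \<longleftrightarrow>
     (\<exists>S. S \<subseteq> carrier G \<and> finite S \<and> generate G S = carrier G \<and>
        (\<exists>\<delta>\<ge>0. hyperbolic_space \<delta> (cayley_points G S) (cayley_metric G S)))"

definition virtually_cyclic :: "('a, 'b) monoid_scheme \<Rightarrow> bool" where
  "virtually_cyclic G \<longleftrightarrow>
     (\<exists>H. subgroup H G \<and> cyclic_group (G\<lparr>carrier := H\<rparr>) \<and> finite (rcosets\<^bsub>G\<^esub> H))"

abbreviation non_elementary :: "('a, 'b) monoid_scheme \<Rightarrow> bool" where
  "non_elementary G \<equiv> \<not> virtually_cyclic G"

end

theory Submission
  imports Defs
begin

text \<open>
  Let \<open>(x | y)\<close> be the Gromov product at \<open>\<one>\<close> for the word metric, and let \<open>K\<close> be a finite set that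
  contains \<open>\<one>\<close>. The tile is \<open>F = K \<union> \<Phi>\<close> for a finite set \<open>\<Phi>\<close> of very long elements. Every point \<open>p\<close> of
  the group gets one translate of \<open>F\<close> that could cover it, namely \<open>p f\<inverse> F\<close>, where \<open>f \<in> \<Phi>\<close> is chosen
  such that \<open>(p\<inverse> | f\<inverse>)\<close> is small. Then a geodesic from \<open>\<one>\<close> to \<open>p\<close> can be prolonged to
  \<open>g = p f\<inverse>\<close>, and from there to any other point of \<open>g F\<close>, almost without backtracking, so \<open>p\<close> is
  the shortest point of the translate. Hence the points can be treated in the order of their lengths:
  whenever \<open>p\<close> is not yet covered, add the translate that belongs to \<open>p\<close>
  (\<open>greedy_tiling\<close>).

  Two of these translates \<open>g F\<close> and \<open>g' F\<close> could still meet in a point \<open>q = g x = g' y\<close> other than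
  their shortest points \<open>p\<close> and \<open>p'\<close>. Seen from \<open>q\<close>, both paths to \<open>\<one>\<close> through \<open>p\<close> and
  \<open>p'\<close> follow the same geodesic. If the elements of \<open>\<Phi>\<close> and their inverses point in pairwise different
  directions, even after translation by an element of \<open>K K\<inverse>\<close>, this leaves only one case besides
  \<open>g = g'\<close>: the points \<open>x\<close> and \<open>y\<close> lie in \<open>K\<close>, the translates use the same \<open>f\<close>, and \<open>p\<close>
  is at most \<open>r\<close> away from \<open>p'\<close>. Here \<open>r\<close> depends on \<open>K\<close>, but not on \<open>\<Phi>\<close>. So colour the
  group in such a way that distinct points at distance at most \<open>r\<close> have different colours; finitely
  many colours suffice, as balls are finite. Each colour gets its own two elements \<open>a, b\<close> of \<open>\<Phi>\<close>, and
  \<open>f\<close> is one of the two that belong to the colour of \<open>p\<close>. A choice between two is what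
  smallness of \<open>(p\<inverse> | f\<inverse>)\<close> needs: by hyperbolicity, \<open>p\<inverse>\<close> cannot follow both \<open>a\<inverse>\<close> and
  \<open>b\<inverse>\<close> if these diverge. The bound on \<open>(a\<inverse> | b\<inverse>)\<close> enters \<open>r\<close> and so must not depend on the
  number of colours, whereas the bound on the other products may
  (\<open>tile_from_independent_family\<close>).

  The elements of \<open>\<Phi>\<close> come from one element \<open>h\<close> whose powers form a quasi-geodesic, which every infinite
  hyperbolic group has (\<open>exists_translation\<close>, \<open>quasi_axisI\<close>). The elements that conjugate a
  nontrivial power of \<open>h\<close> to a nontrivial power of \<open>h\<close> form a subgroup that stays close to the powers of \<open>h\<close>;
  if it were the whole group, the group would be virtually cyclic. For an element \<open>g\<close> outside it, the
  translated axes \<open>h\<^sup>\<alpha> g \<langle>h\<rangle>\<close> have pairwise different ends, and the elements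
  \<open>h\<^sup>\<alpha> g h\<^sup>n g\<inverse> h\<^sup>-\<^sup>\<beta>\<close> with large \<open>n\<close> have the required properties for suitable \<open>\<alpha>, \<beta>\<close>. The inverse of
  such an element first follows \<open>h\<^sup>\<beta>\<close>; a positive \<open>\<beta>\<close> for \<open>a\<close> and a negative one
  for \<open>b\<close> therefore bound \<open>(a\<inverse> | b\<inverse>)\<close> once and for all
  (\<open>independent_family\<close>).
\<close>

section \<open>Gromov products and slim triangles\<close>

definition gromov_product :: "('p \<Rightarrow> 'p \<Rightarrow> real) \<Rightarrow> 'p \<Rightarrow> 'p \<Rightarrow> 'p \<Rightarrow> real" where
  "gromov_product d w x y = (d w x + d w y - d x y) / 2"

locale gromov_hyperbolic = Metric_space M d for M :: "'p set" and d +
  fixes \<delta> :: real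
  assumes four_point: "\<lbrakk>w \<in> M; x \<in> M; y \<in> M; z \<in> M\<rbrakk> \<Longrightarrow>
    min (gromov_product d w x y) (gromov_product d w y z) \<le> gromov_product d w x z + \<delta>"
begin

abbreviation gp :: "'p \<Rightarrow> 'p \<Rightarrow> 'p \<Rightarrow> real" where
  "gp \<equiv> gromov_product d"

lemma gp_commute: "gp w x y = gp w y x"
  by (simp add: gromov_product_def commute)

lemma gp_base: "w \<in> M \<Longrightarrow> gp w w x = 0" "w \<in> M \<Longrightarrow> gp w x w = 0"
  using commute[of x w] by (simp_all add: gromov_product_def)

lemma gp_nonneg: "\<lbrakk>w \<in> M; x \<in> M; y \<in> M\<rbrakk> \<Longrightarrow> 0 \<le> gp w x y"
  using triangle[of x w y] commute[of x w] by (simp add: gromov_product_def)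

lemma gp_le: "\<lbrakk>w \<in> M; x \<in> M; y \<in> M\<rbrakk> \<Longrightarrow> gp w x y \<le> d w x"
  using triangle[of w x y] by (simp add: gromov_product_def)

lemma gp_ge: "\<lbrakk>w \<in> M; x \<in> M; y \<in> M\<rbrakk> \<Longrightarrow> d w x - d x y \<le> gp w x y"
  using triangle[of w y x] commute[of x y] by (simp add: gromov_product_def)

lemma gp_switch_base: "gp w x y + gp x w y = d w x"
  using commute[of x w] by (simp add: gromov_product_def field_simps)

lemma gp_change_base: "\<lbrakk>w \<in> M; v \<in> M; x \<in> M; y \<in> M\<rbrakk> \<Longrightarrow> gp w x y \<le> gp v x y + d w v"
  using triangle[of w v x] triangle[of w v y] by (simp add: gromov_product_def field_simps)

lemma gp_change_point: "\<lbrakk>w \<in> M; x \<in> M; y \<in> M; z \<in> M\<rbrakk> \<Longrightarrow> gp w x y \<le> gp w z y + d x z"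
  using triangle[of w z x] triangle[of z x y] commute[of x z]
  by (simp add: gromov_product_def field_simps)

lemma delta_nonneg: "x \<in> M \<Longrightarrow> 0 \<le> \<delta>"
  using four_point[of x x x x] by simp

text \<open>
  A chain without large backtracking stays close to a geodesic between its ends, and \<open>w\<close> is close to
  such a geodesic too. Walking along the chain, the point seen from \<open>w\<close> changes from the direction of
  the first point to that of the last one; where the direction switches, the chain passes \<open>w\<close>.
\<close>

lemma chain_passes_near:
  fixes x :: "nat \<Rightarrow> 'p"
  assumes x: "\<And>i. i \<le> n \<Longrightarrow> x i \<in> M" and "0 \<le> s"
    and step: "\<And>i. i < n \<Longrightarrow> d (x i) (x (Suc i)) \<le> s"
    and straight: "\<And>i. i \<le> n \<Longrightarrow> gp (x i) (x 0) (x n) \<le> A"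
    and w: "w \<in> M" "gp w (x 0) (x n) \<le> B"
  shows "\<exists>i\<le>n. d w (x i) \<le> A + 2 * B + 2 * \<delta> + s"
proof -
  have pos: "0 \<le> \<delta>" "0 \<le> A" "0 \<le> B"
    using delta_nonneg[OF w(1)] straight[of 0] gp_nonneg[of "x 0" "x 0" "x n"]
      gp_nonneg[of w "x 0" "x n"] w x[of 0] x[of n] by auto
  define i where "i = (LEAST i. gp w (x 0) (x i) \<le> B + \<delta>)"
  have "gp w (x 0) (x n) \<le> B + \<delta>" using w pos by simp
  then have i: "gp w (x 0) (x i) \<le> B + \<delta>" "i \<le> n"
    unfolding i_def by (rule LeastI, rule Least_le)
  show ?thesis
  proof (cases i)
    case 0
    then have "d w (x 0) \<le> B + \<delta>" using i x[of 0] w by (simp add: gromov_product_def)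
    then show ?thesis using pos \<open>0 \<le> s\<close> by (intro exI[of _ 0]) auto
  next
    case (Suc j)
    have j: "j \<le> n" "j < n" using Suc i by auto
    have notj: "gp w (x 0) (x j) > B + \<delta>"
      using not_less_Least[of j "\<lambda>i. gp w (x 0) (x i) \<le> B + \<delta>"] Suc i_def by auto
    have "gp w (x j) (x n) \<le> B + \<delta>"
      using four_point[of w "x 0" "x j" "x n"] w x[of 0] x[of n] x[of j] j notj by auto
    moreover have "gp w (x 0) (x j) \<le> B + \<delta> + s"
      using gp_change_point[of w "x j" "x 0" "x i"] step[of j] i Suc j w x[of 0] x[of i] x[of j]
      by (simp add: gp_commute)
    moreover have "gp (x j) (x 0) (x n) \<le> A" using straight j by simp
    moreover have "d (x 0) (x n) \<le> d w (x 0) + d w (x n)"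
      using triangle[of "x 0" w "x n"] commute[of w "x 0"] w x[of 0] x[of n] by simp
    ultimately have "d w (x j) \<le> A + 2 * B + 2 * \<delta> + s"
      using commute[of "x 0" "x j"] by (simp add: gromov_product_def field_simps)
    then show ?thesis using j by blast
  qed
qed

end

lemma geodesic_segment_between:
  assumes "Metric_space M d" "geodesic_segment M d x y A" "p \<in> A"
  shows "p \<in> M" "d x p + d p y = d x y"
proof -
  obtain l f where f: "0 \<le> l" "f ` {0..l} \<subseteq> M" "f 0 = x" "f l = y"
      "\<And>s t. s \<in> {0..l} \<Longrightarrow> t \<in> {0..l} \<Longrightarrow> d (f s) (f t) = \<bar>s - t\<bar>" "A = f ` {0..l}"
    using assms(2) unfolding geodesic_segment_def by blast
  obtain t where t: "t \<in> {0..l}" "p = f t" using assms f by auto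
  show "p \<in> M" using f t by auto
  show "d x p + d p y = d x y"
    using f(5)[of 0 t] f(5)[of t l] f(5)[of 0 l] f(1,3,4) t by auto
qed

text \<open>
  The side \<open>[x, z]\<close> of a slim triangle starts close to \<open>[w, x]\<close> and ends close to \<open>[z, w]\<close>, so
  some point on it is close to both. At this point the triangle inequalities for \<open>w\<close> are almost
  equalities. Testing only unit steps along the side costs the summand \<open>1\<close>.
\<close>

lemma slim_triangle_projection:
  assumes hyp: "hyperbolic_space \<delta> M d" and "0 \<le> \<delta>"
    and M: "w \<in> M" "x \<in> M" "z \<in> M" and B: "geodesic_segment M d x z B"
  shows "\<exists>p\<in>B. d w p \<le> gromov_product d w x z + 2 * \<delta> + 1"
proof -
  have met: "Metric_space M d" and geo: "\<And>x y. x \<in> M \<Longrightarrow> y \<in> M \<Longrightarrow> \<exists>A. geodesic_segment M d x y A"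
    using hyp unfolding hyperbolic_space_def geodesic_metric_space_def by auto
  interpret Metric_space M d by (rule met)
  obtain A C where A: "geodesic_segment M d w x A" and C: "geodesic_segment M d z w C"
    using geo M by meson
  have slim: "B \<subseteq> neighborhood M d \<delta> (C \<union> A)"
    using hyp M A B C unfolding hyperbolic_space_def by blast
  obtain l f where f: "0 \<le> l" "f ` {0..l} \<subseteq> M" "f 0 = x" "f l = z"
      "\<And>s t. s \<in> {0..l} \<Longrightarrow> t \<in> {0..l} \<Longrightarrow> d (f s) (f t) = \<bar>s - t\<bar>" "B = f ` {0..l}"
    using B unfolding geodesic_segment_def by blast
  define t where "t n = min (real n) l" for n :: nat
  have t: "t n \<in> {0..l}" for n using f(1) by (auto simp: t_def)
  have fB: "f (t n) \<in> B" "f (t n) \<in> M" for n using t f by auto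
  define nearC where "nearC n \<longleftrightarrow> (\<exists>q\<in>C. d (f (t n)) q \<le> \<delta>)" for n
  define n where "n = (LEAST n. nearC n)"
  have "z \<in> C" using C unfolding geodesic_segment_def
    by (metis atLeastAtMost_iff image_eqI order_refl)
  have "x \<in> A" using A unfolding geodesic_segment_def
    by (metis atLeastAtMost_iff image_eqI order_refl)
  have "nearC (nat \<lceil>l\<rceil>)"
  proof -
    have "t (nat \<lceil>l\<rceil>) = l" unfolding t_def using f(1) by linarith
    then show ?thesis
      unfolding nearC_def using \<open>z \<in> C\<close> f(4) M \<open>0 \<le> \<delta>\<close> by (intro bexI[of _ z]) auto
  qed
  then have n: "nearC n" unfolding n_def by (rule LeastI)
  define m where "m = n - 1"
  have "\<exists>q\<in>A. d (f (t m)) q \<le> \<delta>"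
  proof (cases n)
    case 0
    then have "f (t m) = x" using f by (simp add: m_def t_def)
    then show ?thesis using \<open>x \<in> A\<close> M \<open>0 \<le> \<delta>\<close> by force
  next
    case (Suc k)
    then have "\<not> nearC m" using not_less_Least[of m nearC] by (simp add: m_def n_def[symmetric])
    then show ?thesis using slim fB(1)[of m] unfolding neighborhood_def nearC_def by blast
  qed
  then obtain q where q: "q \<in> A" "d (f (t m)) q \<le> \<delta>" by blast
  obtain r where r: "r \<in> C" "d (f (t n)) r \<le> \<delta>" using n nearC_def by blast
  have "d (f (t m)) (f (t n)) \<le> 1" using f(5)[OF t t, of m n] by (auto simp: m_def t_def)
  define p where "p = f (t m)"
  have p: "p \<in> B" "p \<in> M" using fB p_def by auto
  note qM = geodesic_segment_between[OF met A q(1)]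
  note rM = geodesic_segment_between[OF met C r(1)]
  note pM = geodesic_segment_between[OF met B p(1)]
  have pq: "d p q \<le> \<delta>" using q p_def by simp
  have pr: "d p r \<le> \<delta> + 1"
    using triangle[of p "f (t n)" r] p_def r fB rM(1) \<open>d (f (t m)) (f (t n)) \<le> 1\<close> by fastforce
  have "d w p \<le> d w q + \<delta>" "d x p \<le> d q x + \<delta>"
    using triangle[of w q p] triangle[of p q x] pq M p qM(1) commute[of p q] commute[of x p] by auto
  moreover have "d w p \<le> d r w + \<delta> + 1" "d p z \<le> d z r + \<delta> + 1"
    using triangle[of p r w] triangle[of p r z] pr M p rM(1) commute[of w p] commute[of z r] by auto
  ultimately have "d w p \<le> gromov_product d w x z + 2 * \<delta> + 1"
    using qM(2) rM(2) pM(2) commute[of w z] by (simp add: gromov_product_def field_simps)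
  then show ?thesis using p by blast
qed

text \<open>
  The distance from \<open>w\<close> to a geodesic \<open>[x, y]\<close> is at least the Gromov product of \<open>x\<close> and \<open>y\<close>,
  and at most slightly larger. So the four-point inequality says that the point of \<open>[x, z]\<close> nearest
  to \<open>w\<close> is close to one of the two other sides of a triangle.
\<close>

lemma hyperbolic_space_imp_gromov_hyperbolic:
  assumes hyp: "hyperbolic_space \<delta> M d" and "0 \<le> \<delta>"
  shows "gromov_hyperbolic M d (3 * \<delta> + 1)"
proof -
  have met: "Metric_space M d" and geo: "\<And>x y. x \<in> M \<Longrightarrow> y \<in> M \<Longrightarrow> \<exists>A. geodesic_segment M d x y A"
    using hyp unfolding hyperbolic_space_def geodesic_metric_space_def by auto
  interpret Metric_space M d by (rule met)
  have below: "gromov_product d w x y \<le> d w q"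
    if "geodesic_segment M d x y A" "q \<in> A" "w \<in> M" "x \<in> M" "y \<in> M" for w x y q A
    using geodesic_segment_between[OF met that(1,2)] triangle[of w q x] triangle[of w q y] that
      commute[of x q] by (simp add: gromov_product_def)
  show ?thesis
  proof (intro gromov_hyperbolic.intro gromov_hyperbolic_axioms.intro met)
    fix w x y z assume M: "w \<in> M" "x \<in> M" "y \<in> M" "z \<in> M"
    obtain A B C where A: "geodesic_segment M d x y A" and B: "geodesic_segment M d y z B"
      and C: "geodesic_segment M d z x C" using geo M by meson
    obtain p where p: "p \<in> C" "d w p \<le> gromov_product d w z x + 2 * \<delta> + 1"
      using slim_triangle_projection[OF hyp \<open>0 \<le> \<delta>\<close> M(1,4,2) C] by blast
    have "C \<subseteq> neighborhood M d \<delta> (A \<union> B)"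
      using hyp M A B C unfolding hyperbolic_space_def by blast
    then obtain q where q: "q \<in> A \<union> B" "d p q \<le> \<delta>" "p \<in> M"
      using p(1) unfolding neighborhood_def by blast
    have qM: "q \<in> M"
      using q(1) geodesic_segment_between(1)[OF met A] geodesic_segment_between(1)[OF met B] by blast
    have "d w q \<le> gromov_product d w z x + 3 * \<delta> + 1"
      using p(2) q(2,3) triangle[of w p q] M qM by auto
    moreover have "min (gromov_product d w x y) (gromov_product d w y z) \<le> d w q"
      using q(1) below[OF A _ M(1,2,3)] below[OF B _ M(1,3,4)] by (auto simp: min_le_iff_disj)
    moreover have "gromov_product d w z x = gromov_product d w x z"
      by (simp add: gromov_product_def commute[of z x])
    ultimately show "min (gromov_product d w x y) (gromov_product d w y z)
        \<le> gromov_product d w x z + (3 * \<delta> + 1)"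
      by linarith
  qed
qed

section \<open>Groups with a hyperbolic word metric\<close>

text \<open>
  Interpolation replaces geodesics: it holds for word metrics, since a shortest word can be cut at any
  letter.
\<close>

locale hyperbolic_group = group G + gromov_hyperbolic "carrier G" d \<delta>
  for G :: "('a, 'b) monoid_scheme" (structure) and d \<delta> +
  assumes left_invariant:
    "\<lbrakk>a \<in> carrier G; x \<in> carrier G; y \<in> carrier G\<rbrakk> \<Longrightarrow> d (a \<otimes> x) (a \<otimes> y) = d x y"
  and finite_balls: "finite {x \<in> carrier G. d \<one> x \<le> r}"
  and interpolation: "\<lbrakk>x \<in> carrier G; real n \<le> d \<one> x\<rbrakk> \<Longrightarrow>
    \<exists>u \<in> carrier G. d \<one> u = real n \<and> d u x = d \<one> x - real n"
begin

lemma gp_translate: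
  "\<lbrakk>a \<in> carrier G; w \<in> carrier G; x \<in> carrier G; y \<in> carrier G\<rbrakk>
    \<Longrightarrow> gp (a \<otimes> w) (a \<otimes> x) (a \<otimes> y) = gp w x y"
  by (simp add: gromov_product_def left_invariant)

lemma dist_eq_length: "\<lbrakk>x \<in> carrier G; y \<in> carrier G\<rbrakk> \<Longrightarrow> d x y = d \<one> (inv x \<otimes> y)"
  using left_invariant[of "inv x" x y] by simp

lemma length_inv: "x \<in> carrier G \<Longrightarrow> d \<one> (inv x) = d \<one> x"
  using dist_eq_length[of x \<one>] by (simp add: commute)

lemma dist_mult_right: "\<lbrakk>x \<in> carrier G; y \<in> carrier G\<rbrakk> \<Longrightarrow> d x (x \<otimes> y) = d \<one> y"
  using left_invariant[of x \<one> y] by simp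

lemma gp_at: "\<lbrakk>w \<in> carrier G; x \<in> carrier G; y \<in> carrier G\<rbrakk>
    \<Longrightarrow> gp w x y = gp \<one> (inv w \<otimes> x) (inv w \<otimes> y)"
  using gp_translate[of "inv w" w x y] by simp

lemma length_mult_le: "\<lbrakk>x \<in> carrier G; y \<in> carrier G\<rbrakk> \<Longrightarrow> d \<one> (x \<otimes> y) \<le> d \<one> x + d \<one> y"
  using triangle[of \<one> x "x \<otimes> y"] by (simp add: dist_mult_right)

lemma length_mult_ge: "\<lbrakk>x \<in> carrier G; y \<in> carrier G\<rbrakk> \<Longrightarrow> d \<one> y - d \<one> x \<le> d \<one> (x \<otimes> y)"
    "\<lbrakk>x \<in> carrier G; y \<in> carrier G\<rbrakk> \<Longrightarrow> d \<one> x - d \<one> y \<le> d \<one> (x \<otimes> y)"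
  using length_mult_le[of "inv x" "x \<otimes> y"] length_mult_le[of "x \<otimes> y" "inv y"]
  by (simp_all add: length_inv m_assoc) (simp add: m_assoc[symmetric])

lemma gp_mult_right_le:
  assumes "x \<in> carrier G" "y \<in> carrier G" "u \<in> carrier G" "v \<in> carrier G"
  shows "gp \<one> (x \<otimes> u) (y \<otimes> v) \<le> gp \<one> x y + d \<one> u + d \<one> v"
  using gp_change_point[of \<one> "x \<otimes> u" "y \<otimes> v" x] gp_change_point[of \<one> "y \<otimes> v" x y] assms
    dist_mult_right[of x u] dist_mult_right[of y v] by (simp add: gp_commute commute)

lemma gp_rebase:
  assumes "g \<in> carrier G" "z \<in> carrier G" "w \<in> carrier G"
  shows "gp \<one> (inv (g \<otimes> z)) w \<le> gp \<one> (inv g) (z \<otimes> w) + d \<one> z"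
  using gp_change_base[of "g \<otimes> z" g \<one> "g \<otimes> z \<otimes> w"] assms
    gp_translate[of "g \<otimes> z" \<one> "inv (g \<otimes> z)" w] gp_translate[of g \<one> "inv g" "z \<otimes> w"]
    dist_mult_right[of g z] by (simp add: m_assoc commute)

lemma mult_inv_cancel: "\<lbrakk>x \<in> carrier G; y \<in> carrier G\<rbrakk> \<Longrightarrow> inv x \<otimes> (x \<otimes> y) = y"
  by (simp add: m_assoc[symmetric])

end

section \<open>The word metric of a word hyperbolic group\<close>

definition vertex_point :: "'v \<Rightarrow> 'v \<Rightarrow> real" where
  "vertex_point v = (\<lambda>w. if w = v then 1 else 0)"

lemma vertex_point_inject: "vertex_point u = vertex_point v \<longleftrightarrow> u = v"
  by (auto simp: vertex_point_def fun_eq_iff split: if_splits)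

lemma support_vertex_point: "{w. vertex_point v w \<noteq> 0} = {v}"
  by (auto simp: vertex_point_def)

lemma vertex_point_in_graph: "v \<in> V \<Longrightarrow> vertex_point v \<in> graph_points V E"
  unfolding graph_points_def closed_edge_def by (auto simp: vertex_point_def)

text \<open>
  On vertices the metric of the geometric realisation is the path metric, so the hyperbolicity of the
  Cayley graph restricts to the word metric.
\<close>

lemma graph_metric_vertices:
  assumes E: "sym E" "\<And>u v. (u, v) \<in> E \<Longrightarrow> u \<noteq> v" and V: "g \<in> V" "h \<in> V"
  shows "graph_metric V E (vertex_point g) (vertex_point h) = real (edge_path_dist E g h)"
proof -
  have end_point: "v = u \<or> v = u'" if "vertex_point v \<in> closed_edge u u'" for v u u'
    using that by (auto simp: closed_edge_def support_vertex_point)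
  consider (same) "g = h" | (adj) "g \<noteq> h" "\<exists>(u, v)\<in>E. vertex_point g \<in> closed_edge u v \<and> vertex_point h \<in> closed_edge u v"
    | (far) "g \<noteq> h" "\<not> (\<exists>(u, v)\<in>E. vertex_point g \<in> closed_edge u v \<and> vertex_point h \<in> closed_edge u v)"
    by blast
  then show ?thesis
  proof cases
    case same
    have "edge_path_dist E g g = 0" unfolding edge_path_dist_def by (rule Least_equality) auto
    then show ?thesis using same V by (simp add: graph_metric_def vertex_point_in_graph)
  next
    case adj
    then obtain u v where uv: "(u, v) \<in> E" "vertex_point g \<in> closed_edge u v" "vertex_point h \<in> closed_edge u v"
      by blast
    then have "(g, h) \<in> E" using end_point[OF uv(2)] end_point[OF uv(3)] adj(1) E(1) by (auto dest: symD)
    then have "edge_path_dist E g h = 1"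
      unfolding edge_path_dist_def using adj(1)
      by (intro Least_equality) (auto simp: Suc_le_eq intro: gr0I)
    moreover have "graph_metric V E (vertex_point g) (vertex_point h) =
        (\<Sum>w\<in>{g} \<union> {h}. \<bar>vertex_point g w - vertex_point h w\<bar>) / 2"
      using adj V unfolding graph_metric_def by (simp add: vertex_point_in_graph support_vertex_point)
    moreover have "(\<Sum>w\<in>{g} \<union> {h}. \<bar>vertex_point g w - vertex_point h w\<bar>) = 2"
      using adj(1) by (simp add: vertex_point_def)
    ultimately show ?thesis by simp
  next
    case far
    then have "\<not> (vertex_point g = vertex_point h \<or>
        (\<exists>(u, v)\<in>E. vertex_point g \<in> closed_edge u v \<and> vertex_point h \<in> closed_edge u v))"
      by (simp only: vertex_point_inject simp_thms)
    moreover have "\<not> (vertex_point g \<notin> graph_points V E \<or> vertex_point h \<notin> graph_points V E)"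
      using V by (simp add: vertex_point_in_graph)
    ultimately have "graph_metric V E (vertex_point g) (vertex_point h) =
      Min ((\<lambda>(u, v). (1 - vertex_point g u) + real (edge_path_dist E u v) + (1 - vertex_point h v)) `
                  ({g} \<times> {h}))"
      unfolding graph_metric_def support_vertex_point by (simp only: if_not_P if_False)
    then show ?thesis by (simp add: vertex_point_def)
  qed
qed

lemma sym_relpow: "sym E \<Longrightarrow> (x, y) \<in> E ^^ n \<Longrightarrow> (y, x) \<in> E ^^ n"
proof (induction n arbitrary: y)
  case (Suc n)
  then obtain z where "(x, z) \<in> E ^^ n" "(z, y) \<in> E" by auto
  then show ?case using Suc by (metis relpow_Suc_I2 symD)
qed simp

lemma edge_path_dist_commute: "sym E \<Longrightarrow> edge_path_dist E x y = edge_path_dist E y x"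
  using sym_relpow[of E x y] sym_relpow[of E y x]
  unfolding edge_path_dist_def by (intro arg_cong[where f = Least] ext iffI)

lemma finite_relpow_image:
  fixes E :: "('v \<times> 'v) set"
  assumes "\<And>x. finite (E `` {x})"
  shows "finite {y. (x, y) \<in> E ^^ n}"
proof (induction n)
  case (Suc n)
  have "{y. (x, y) \<in> E ^^ Suc n} \<subseteq> (\<Union>z\<in>{z. (x, z) \<in> E ^^ n}. E `` {z})" by auto
  then show ?case using Suc assms finite_subset by (metis (no_types, lifting) finite_UN_I)
qed simp

context group begin

lemma sym_cayley_edges: "sym (cayley_edges G S)"
  unfolding sym_def cayley_edges_def by blast

lemma cayley_relpow_mem: "(x, y) \<in> cayley_edges G S ^^ n \<Longrightarrow> x \<in> carrier G \<Longrightarrow> y \<in> carrier G"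
proof (induction n arbitrary: y)
  case (Suc n)
  then obtain z where "(z, y) \<in> cayley_edges G S" by auto
  then show ?case by (simp add: cayley_edges_def)
qed simp

lemma cayley_edges_translate:
  assumes "a \<in> carrier G" "S \<subseteq> carrier G" "(x, y) \<in> cayley_edges G S"
  shows "(a \<otimes> x, a \<otimes> y) \<in> cayley_edges G S"
proof -
  have "x \<in> carrier G" "y \<in> carrier G" "x \<noteq> y" "\<exists>s\<in>S. y = x \<otimes> s \<or> x = y \<otimes> s"
    using assms(3) by (auto simp: cayley_edges_def)
  moreover from this have "\<exists>s\<in>S. a \<otimes> y = a \<otimes> x \<otimes> s \<or> a \<otimes> x = a \<otimes> y \<otimes> s"
    using assms(1,2) by (metis m_assoc subsetD)
  ultimately show ?thesis using assms(1) by (simp add: cayley_edges_def)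
qed

lemma cayley_relpow_translate:
  assumes "a \<in> carrier G" "S \<subseteq> carrier G"
  shows "(x, y) \<in> cayley_edges G S ^^ n \<Longrightarrow> (a \<otimes> x, a \<otimes> y) \<in> cayley_edges G S ^^ n"
proof (induction n arbitrary: y)
  case (Suc n)
  then obtain z where "(x, z) \<in> cayley_edges G S ^^ n" "(z, y) \<in> cayley_edges G S" by auto
  then show ?case using Suc.IH cayley_edges_translate[OF assms] by (meson relpow_Suc_I)
qed simp

lemma cayley_dist_translate:
  assumes "a \<in> carrier G" "S \<subseteq> carrier G" "x \<in> carrier G" "y \<in> carrier G"
  shows "edge_path_dist (cayley_edges G S) (a \<otimes> x) (a \<otimes> y) = edge_path_dist (cayley_edges G S) x y"
proof -
  have "(a \<otimes> x, a \<otimes> y) \<in> cayley_edges G S ^^ n \<longleftrightarrow> (x, y) \<in> cayley_edges G S ^^ n" for n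
    using cayley_relpow_translate[of a S x y n] cayley_relpow_translate[of "inv a" S "a \<otimes> x" "a \<otimes> y" n] assms
    by (auto simp: m_assoc[symmetric])
  then show ?thesis by (simp add: edge_path_dist_def)
qed

lemma cayley_connected:
  assumes S: "S \<subseteq> carrier G" and x: "x \<in> generate G S"
  shows "\<exists>n. (\<one>, x) \<in> cayley_edges G S ^^ n"
  using x
proof (induction rule: generate.induct)
  case one
  show ?case by (intro exI[of _ 0]) simp
next
  case (incl s)
  then have "(\<one>, s) \<in> cayley_edges G S" if "s \<noteq> \<one>"
    using S that by (auto simp: cayley_edges_def intro!: bexI[of _ s])
  then show ?case by (cases "s = \<one>") (auto intro: exI[of _ 0] exI[of _ 1])
next
  case (inv s)
  then have "(\<one>, inv s) \<in> cayley_edges G S" if "inv s \<noteq> \<one>"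
    using S that by (auto simp: cayley_edges_def intro!: bexI[of _ s])
  then show ?case by (cases "inv s = \<one>") (auto intro: exI[of _ 0] exI[of _ 1])
next
  case (eng a b)
  then obtain m n where "(\<one>, a) \<in> cayley_edges G S ^^ m" "(\<one>, b) \<in> cayley_edges G S ^^ n" by blast
  moreover have "a \<in> carrier G" using eng(1) S generate_in_carrier by blast
  ultimately have "(\<one>, a \<otimes> b) \<in> cayley_edges G S ^^ (m + n)"
    using cayley_relpow_translate[of a S \<one> b n] S by (auto simp: relpow_add)
  then show ?case by blast
qed

lemma word_hyperbolic_imp_hyperbolic_group:
  assumes "word_hyperbolic G"
  shows "\<exists>d \<delta>. hyperbolic_group G d \<delta>"
proof -
  obtain S \<delta> where S: "S \<subseteq> carrier G" "finite S" "generate G S = carrier G"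
    and \<delta>: "0 \<le> \<delta>" "hyperbolic_space \<delta> (cayley_points G S) (cayley_metric G S)"
    using assms unfolding word_hyperbolic_def by (elim exE conjE) (rule that)
  define E where "E = cayley_edges G S"
  define d where "d x y = real (edge_path_dist E x y)" for x y
  have sym: "sym E" unfolding E_def by (rule sym_cayley_edges)
  have d: "d x y = cayley_metric G S (vertex_point x) (vertex_point y)"
    if "x \<in> carrier G" "y \<in> carrier G" for x y
  proof -
    have "u \<noteq> v" if "(u, v) \<in> E" for u v using that by (simp add: E_def cayley_edges_def)
    then show ?thesis using graph_metric_vertices[OF sym _ that] by (simp add: d_def E_def)
  qed
  have pts: "vertex_point x \<in> cayley_points G S" if "x \<in> carrier G" for x
    using that by (rule vertex_point_in_graph)
  interpret cayley: gromov_hyperbolic "cayley_points G S" "cayley_metric G S" "3 * \<delta> + 1"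
    using hyperbolic_space_imp_gromov_hyperbolic[OF \<delta>(2,1)] .
  have gp: "gromov_product d w x y = cayley.gp (vertex_point w) (vertex_point x) (vertex_point y)"
    if "w \<in> carrier G" "x \<in> carrier G" "y \<in> carrier G" for w x y
    using that by (simp add: gromov_product_def d)
  have met: "Metric_space (carrier G) d"
  proof
    show "0 \<le> d x y" for x y by (simp add: d_def)
    show "d x y = d y x" for x y using edge_path_dist_commute[OF sym] by (simp add: d_def)
    show "d x y = 0 \<longleftrightarrow> x = y" if "x \<in> carrier G" "y \<in> carrier G" for x y
      using that pts by (simp add: d vertex_point_inject)
    show "d x z \<le> d x y + d y z" if "x \<in> carrier G" "y \<in> carrier G" "z \<in> carrier G" for x y z
      using that pts cayley.triangle by (simp add: d)
  qed
  have path: "(\<one>, x) \<in> E ^^ edge_path_dist E \<one> x" if "x \<in> carrier G" for x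
    using cayley_connected[OF S(1), of x] that S(3) unfolding edge_path_dist_def E_def by (auto intro: LeastI_ex)
  have "hyperbolic_group G d (3 * \<delta> + 1)"
  proof (intro hyperbolic_group.intro gromov_hyperbolic.intro gromov_hyperbolic_axioms.intro
      hyperbolic_group_axioms.intro met)
    show "group G" by (rule group_axioms)
    show "min (gromov_product d w x y) (gromov_product d w y z) \<le> gromov_product d w x z + (3 * \<delta> + 1)"
      if "w \<in> carrier G" "x \<in> carrier G" "y \<in> carrier G" "z \<in> carrier G" for w x y z
      using that pts cayley.four_point by (simp add: gp)
    show "d (a \<otimes> x) (a \<otimes> y) = d x y" if "a \<in> carrier G" "x \<in> carrier G" "y \<in> carrier G" for a x y
      using that S(1) cayley_dist_translate by (simp add: d_def E_def)
    show "finite {x \<in> carrier G. d \<one> x \<le> r}" for r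
    proof -
      have "E `` {x} \<subseteq> (\<lambda>s. x \<otimes> s) ` S \<union> (\<lambda>s. x \<otimes> inv s) ` S" for x
      proof
        fix y assume "y \<in> E `` {x}"
        then obtain s where s: "s \<in> S" "x \<in> carrier G" "y \<in> carrier G" "y = x \<otimes> s \<or> x = y \<otimes> s"
          by (auto simp: E_def cayley_edges_def)
        then have "y = x \<otimes> s \<or> y = x \<otimes> inv s" using S(1) by (auto simp: m_assoc subset_iff)
        then show "y \<in> (\<lambda>s. x \<otimes> s) ` S \<union> (\<lambda>s. x \<otimes> inv s) ` S" using s(1) by blast
      qed
      then have "finite (E `` {x})" for x
        by (rule finite_subset) (use S(2) in simp)
      then have fin: "finite (\<Union>n\<le>nat \<lfloor>r\<rfloor>. {x. (\<one>, x) \<in> E ^^ n})"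
        using finite_relpow_image[of E] by (intro finite_UN_I) simp_all
      have "{x \<in> carrier G. d \<one> x \<le> r} \<subseteq> (\<Union>n\<le>nat \<lfloor>r\<rfloor>. {x. (\<one>, x) \<in> E ^^ n})"
      proof
        fix x assume "x \<in> {x \<in> carrier G. d \<one> x \<le> r}"
        then have x: "x \<in> carrier G" "real (edge_path_dist E \<one> x) \<le> r" by (auto simp: d_def)
        then have "edge_path_dist E \<one> x \<le> nat \<lfloor>r\<rfloor>" by linarith
        then show "x \<in> (\<Union>n\<le>nat \<lfloor>r\<rfloor>. {x. (\<one>, x) \<in> E ^^ n})" using path[OF x(1)] by auto
      qed
      then show ?thesis using fin finite_subset by blast
    qed
    show "\<exists>u\<in>carrier G. d \<one> u = real n \<and> d u x = d \<one> x - real n"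
      if x: "x \<in> carrier G" and n: "real n \<le> d \<one> x" for x n
    proof -
      define k where "k = edge_path_dist E \<one> x - n"
      have k: "edge_path_dist E \<one> x = n + k" using n by (simp add: d_def k_def)
      then obtain u where u: "(\<one>, u) \<in> E ^^ n" "(u, x) \<in> E ^^ k" using path[OF x] by (auto simp: relpow_add)
      have uG: "u \<in> carrier G" using cayley_relpow_mem[OF u(1)[unfolded E_def]] by simp
      have "edge_path_dist E \<one> u \<le> n" "edge_path_dist E u x \<le> k"
        unfolding edge_path_dist_def using u by (auto intro: Least_le)
      moreover have "d \<one> x \<le> d \<one> u + d u x" using Metric_space.triangle[OF met] x uG by simp
      ultimately show ?thesis using k uG by (intro bexI[of _ u]) (auto simp: d_def)
    qed
  qed
  then show ?thesis by blast
qed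

end

section \<open>Powers of an element that form a quasi-geodesic\<close>

context hyperbolic_group begin

text \<open>
  Otherwise \<open>x\<close> and \<open>x\<inverse>\<close> agree along almost half their length for every long \<open>x\<close>: the second half of
  a geodesic word runs back along its first half. Apply this to a geodesic word \<open>g\<close> of length \<open>4 k\<close>,
  to its initial part \<open>u\<close> of length \<open>3 k\<close>, and to the remaining part \<open>h\<close>. The first two
  applications show that \<open>u\<inverse>\<close> follows \<open>h\<inverse>\<close>, the third that \<open>h\<inverse>\<close> follows \<open>h\<close>; but \<open>u\<inverse>\<close> and
  \<open>h\<close> diverge at once, because \<open>g = u h\<close> is geodesic.
\<close>

lemma exists_translation:
  assumes "infinite (carrier G)"
  shows "\<exists>h\<in>carrier G. 2 * gp \<one> h (inv h) + 3 * \<delta> + 1 \<le> d \<one> h"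
proof (rule ccontr)
  assume "\<not> ?thesis"
  then have short: "d \<one> h < 2 * gp \<one> h (inv h) + 3 * \<delta> + 1" if "h \<in> carrier G" for h
    using that by force
  have \<delta>: "0 \<le> \<delta>" using delta_nonneg[of \<one>] by simp
  \<comment> \<open>Large compared with the error terms, which are bounded in terms of \<open>\<delta>\<close>.\<close>
  define k where "k = nat \<lceil>10 * \<delta> + 10\<rceil>"
  have k: "10 * \<delta> + 10 \<le> real k" unfolding k_def by linarith
  have "\<not> carrier G \<subseteq> {x \<in> carrier G. d \<one> x \<le> real (4 * k)}"
    using assms finite_balls[of "real (4 * k)"] finite_subset by blast
  then obtain x where "x \<in> carrier G" "real (4 * k) < d \<one> x" by fastforce
  then obtain g where g: "g \<in> carrier G" "d \<one> g = real (4 * k)"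
    using interpolation[of x "4 * k"] by auto
  then obtain u where u: "u \<in> carrier G" "d \<one> u = real (3 * k)" "d u g = real k"
    using interpolation[of g "3 * k"] by auto
  define h where "h = inv u \<otimes> g"
  have h: "h \<in> carrier G" "g = u \<otimes> h" "d \<one> h = real k"
    using u g dist_eq_length[of u g] by (auto simp: h_def m_assoc[symmetric])
  have dh: "d (inv u) h = real (4 * k)"
    using dist_eq_length[of "inv u" h] u h g by simp
  have dgh: "d (inv g) (inv h) = real (3 * k)"
    using dist_eq_length[of "inv g" "inv h"] u h g by (simp add: m_assoc)
  note inv_mem = inv_closed[OF u(1)] inv_closed[OF g(1)] inv_closed[OF h(1)]
  have gps: "gp \<one> u g = 3 * k" "gp \<one> (inv g) (inv h) = k" "gp \<one> (inv u) h = 0"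
    using u g h dh dgh by (simp_all add: gromov_product_def length_inv field_simps)
  have "3 * k - 3 * \<delta> - 1 < 2 * gp \<one> (inv u) u" "4 * k - 3 * \<delta> - 1 < 2 * gp \<one> g (inv g)"
      "k - 3 * \<delta> - 1 < 2 * gp \<one> (inv h) h"
    using short[OF u(1)] short[OF g(1)] short[OF h(1)] u g h by (auto simp: gp_commute)
  moreover note four_point[of \<one> "inv u" u g] four_point[of \<one> "inv u" g "inv g"]
    four_point[of \<one> "inv u" "inv g" "inv h"] four_point[of \<one> "inv u" "inv h" h]
  ultimately show False using gps k \<delta> u(1) g(1) h(1) inv_mem
    by (simp add: min_def split: if_splits)
qed

definition quasi_axis :: "'a \<Rightarrow> real \<Rightarrow> bool" where
  "quasi_axis h C \<longleftrightarrow> h \<in> carrier G \<and> (\<forall>n::int. real_of_int \<bar>n\<bar> \<le> d \<one> (h [^] n)) \<and>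
     (\<forall>(m::int) (n::int). m \<le> 0 \<longrightarrow> 0 \<le> n \<longrightarrow> gp \<one> (h [^] m) (h [^] n) \<le> C)"

text \<open>
  The local-to-global principle: if each step of a path is long compared with the backtracking at
  its corners, then the backtracking with respect to the whole past stays bounded.
\<close>

lemma powers_go_straight:
  assumes x: "x \<in> carrier G" and A: "2 * A + 3 * \<delta> + 1 \<le> d \<one> x" "gp \<one> x (inv x) \<le> A"
  shows "gp \<one> (inv (x [^] n)) x \<le> A + \<delta> \<and> real n \<le> d \<one> (x [^] (n::nat))"
proof (induction n)
  case 0
  have "gp \<one> \<one> x = 0" using x by (simp add: gromov_product_def)
  moreover have "0 \<le> A" using gp_nonneg[of \<one> x "inv x"] A x by simp
  ultimately show ?case using x delta_nonneg[of \<one>] by simp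
next
  case (Suc n)
  have \<delta>: "0 \<le> \<delta>" using delta_nonneg[of \<one>] by simp
  define y where "y = inv (x [^] Suc n)"
  have y: "y \<in> carrier G" "x \<otimes> y = inv (x [^] n)"
    using x by (auto simp: y_def inv_mult_group m_assoc[symmetric])
  have xn: "x [^] Suc n = x [^] n \<otimes> x" by simp
  have "gp (inv x) \<one> y = gp \<one> x (inv (x [^] n))"
    using gp_at[of "inv x" \<one> y] x y by simp
  then have "d \<one> x - A - \<delta> \<le> gp \<one> (inv x) y"
    using gp_switch_base[of \<one> "inv x" y] Suc x by (simp add: length_inv gp_commute)
  then have "gp \<one> y x \<le> A + \<delta>"
    using four_point[of \<one> x y "inv x"] x y A \<delta> by (auto simp: gp_commute)
  moreover have "d \<one> (x [^] Suc n) = d (inv (x [^] n)) x"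
    using dist_eq_length[of "inv (x [^] n)" x] x by simp
  then have "real (Suc n) \<le> d \<one> (x [^] Suc n)"
    using Suc A \<delta> x by (simp add: gromov_product_def length_inv field_simps)
  ultimately show ?case by (simp add: y_def)
qed

lemma quasi_axisI:
  assumes x: "x \<in> carrier G" and "2 * gp \<one> x (inv x) + 3 * \<delta> + 1 \<le> d \<one> x"
  shows "quasi_axis x (gp \<one> x (inv x) + 2 * \<delta>)"
proof -
  define A where "A = gp \<one> x (inv x)"
  have \<delta>: "0 \<le> \<delta>" using delta_nonneg[of \<one>] by simp
  have A: "0 \<le> A" using gp_nonneg[of \<one> x "inv x"] x by (simp add: A_def)
  have big: "2 * A + 3 * \<delta> + 1 \<le> d \<one> x" using assms by (simp add: A_def)
  note fwd = powers_go_straight[OF x big, unfolded A_def, simplified]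
  have bwd: "gp \<one> (x [^] n) (inv x) \<le> A + \<delta>" for n :: nat
    using powers_go_straight[of "inv x" A n] x big
    by (simp add: A_def gp_commute length_inv nat_pow_inv)
  have pos: "gp \<one> (inv (x [^] m)) (x [^] n) \<le> A + 2 * \<delta>" for m n :: nat
  proof (cases n)
    case 0
    then show ?thesis using x A \<delta> by (simp add: gp_base)
  next
    case (Suc k)
    have "x [^] n = x \<otimes> x [^] k" using x Suc nat_pow_Suc2 by blast
    then have "gp x \<one> (x [^] n) \<le> A + \<delta>"
      using gp_at[of x \<one> "x [^] n"] bwd[of k] x by (simp add: mult_inv_cancel gp_commute)
    then have "d \<one> x - A - \<delta> \<le> gp \<one> x (x [^] n)"
      using gp_switch_base[of \<one> x "x [^] n"] by simp
    then show ?thesis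
      using four_point[of \<one> "inv (x [^] m)" "x [^] n" x] fwd[of m] x A big \<delta>
      by (auto simp: gp_commute A_def)
  qed
  have "real_of_int \<bar>n\<bar> \<le> d \<one> (x [^] n)" for n :: int
    using fwd[THEN conjunct2] x
    by (cases n rule: int_cases2) (simp_all add: int_pow_int int_pow_neg_int length_inv)
  moreover have "gp \<one> (x [^] m) (x [^] n) \<le> A + 2 * \<delta>" if mn: "m \<le> 0" "0 \<le> n" for m n :: int
  proof -
    obtain i k where "m = - int i" "n = int k"
      using mn by (metis int_cases2 neg_0_le_iff_le nat_0_le minus_minus)
    then show ?thesis using pos[of i k] x by (simp add: int_pow_int int_pow_neg_int)
  qed
  ultimately show ?thesis using x unfolding quasi_axis_def A_def by blast
qed

context
  fixes h C assumes ax: "quasi_axis h C"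
begin

lemma axis_mem [simp]: "h \<in> carrier G"
  using ax by (simp add: quasi_axis_def)

lemma axis_length: "real_of_int \<bar>n\<bar> \<le> d \<one> (h [^] (n::int))"
  using ax by (simp add: quasi_axis_def)

lemma axis_opposite: "m \<le> 0 \<Longrightarrow> 0 \<le> n \<Longrightarrow> gp \<one> (h [^] (m::int)) (h [^] (n::int)) \<le> C"
  using ax by (simp add: quasi_axis_def)

lemma axis_nonneg: "0 \<le> C"
  using axis_opposite[of 0 0] by (simp add: gromov_product_def)

lemma axis_pow_add: "h [^] (m + n :: int) = h [^] m \<otimes> h [^] n"
  by (simp add: int_pow_mult)

lemma axis_dist: "d (h [^] (m::int)) (h [^] n) = d \<one> (h [^] (n - m))"
  using left_invariant[of "h [^] m" \<one> "h [^] (n - m)"] by (simp add: axis_pow_add[symmetric])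

lemma axis_between:
  assumes "i \<le> j" "j \<le> (k::int)"
  shows "gp (h [^] j) (h [^] i) (h [^] k) \<le> C"
  using axis_opposite[of "i - j" "k - j"] assms
    gp_translate[of "h [^] j" \<one> "h [^] (i - j)" "h [^] (k - j)"]
  by (simp add: axis_pow_add[symmetric])

lemma axis_inj: "h [^] (m::int) = h [^] n \<longleftrightarrow> m = n"
proof
  assume "h [^] m = h [^] n"
  then have "d \<one> (h [^] (n - m)) = 0" using axis_dist[of m n] by simp
  then show "m = n" using axis_length[of "n - m"] by linarith
qed simp

lemma axis_step: "d (h [^] (n::int)) (h [^] (n + 1)) = d \<one> h" "d (h [^] (n::int)) (h [^] (n - 1)) = d \<one> h"
  using length_inv[of h] by (simp_all add: axis_dist int_pow_neg)

lemma axis_length_le: "d \<one> (h [^] (n::int)) \<le> \<bar>n\<bar> * d \<one> h"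
proof -
  have nat: "d \<one> (h [^] int n) \<le> n * d \<one> h" for n :: nat
  proof (induction n)
    case (Suc n)
    then show ?case using triangle[of \<one> "h [^] int n" "h [^] (int n + 1)"] axis_step(1)[of "int n"]
      by (simp add: field_simps)
  qed simp
  show ?thesis using nat[of "nat \<bar>n\<bar>"]
    by (cases "0 \<le> n") (auto simp: length_inv int_pow_neg)
qed

definition axis_radius :: real where
  "axis_radius = C + 2 * (C + 2 * \<delta>) + 2 * \<delta> + d \<one> h"

text \<open>
  Both directions along the axis occur, since nothing fixes the signs of the exponents of two axes that
  follow each other.
\<close>

lemma axis_passes_near:
  fixes \<sigma> :: int
  assumes \<sigma>: "\<sigma> = 1 \<or> \<sigma> = - 1" and g: "g \<in> carrier G" "w \<in> carrier G"
    and near: "gp w (g \<otimes> h [^] a) (g \<otimes> h [^] (a + \<sigma> * int n)) \<le> C + 2 * \<delta>"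
  shows "\<exists>i\<le>n. d w (g \<otimes> h [^] (a + \<sigma> * int i)) \<le> axis_radius"
  unfolding axis_radius_def
proof (rule chain_passes_near)
  fix i assume i: "i \<le> n"
  have "gp (h [^] (a + \<sigma> * int i)) (h [^] (a + \<sigma> * int 0)) (h [^] (a + \<sigma> * int n)) \<le> C"
    using \<sigma>
  proof
    assume "\<sigma> = 1"
    then have "a + \<sigma> * int 0 \<le> a + \<sigma> * int i" "a + \<sigma> * int i \<le> a + \<sigma> * int n" using i by auto
    then show ?thesis by (rule axis_between)
  next
    assume "\<sigma> = - 1"
    then have "a + \<sigma> * int n \<le> a + \<sigma> * int i" "a + \<sigma> * int i \<le> a + \<sigma> * int 0" using i by auto
    then show ?thesis by (subst gp_commute) (rule axis_between)
  qed
  then show "gp (g \<otimes> h [^] (a + \<sigma> * int i)) (g \<otimes> h [^] (a + \<sigma> * int 0))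
      (g \<otimes> h [^] (a + \<sigma> * int n)) \<le> C"
    by (subst gp_translate) (use g in auto)
next
  fix i assume "i < n"
  have "d (h [^] (a + \<sigma> * int i)) (h [^] (a + \<sigma> * int (Suc i))) = d \<one> h"
    using \<sigma>
  proof
    assume "\<sigma> = 1"
    then have "a + \<sigma> * int (Suc i) = (a + \<sigma> * int i) + 1" by simp
    then show ?thesis by (simp only: axis_step)
  next
    assume "\<sigma> = - 1"
    then have "a + \<sigma> * int (Suc i) = (a + \<sigma> * int i) - 1" by simp
    then show ?thesis by (simp only: axis_step)
  qed
  then show "d (g \<otimes> h [^] (a + \<sigma> * int i)) (g \<otimes> h [^] (a + \<sigma> * int (Suc i))) \<le> d \<one> h"
    by (subst left_invariant) (use g in auto)
qed (use g near in \<open>simp_all\<close>)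

section \<open>Elements that preserve the axis\<close>

definition commensurator :: "'a set" where
  "commensurator = {g \<in> carrier G. \<exists>(i::int) (j::int). i \<noteq> 0 \<and> j \<noteq> 0 \<and> g \<otimes> h [^] i = h [^] j \<otimes> g}"

lemma commensurator_mem: "g \<in> commensurator \<Longrightarrow> g \<in> carrier G"
  by (simp add: commensurator_def)

lemma intertwining_powers:
  assumes g: "g \<in> carrier G" and ij: "g \<otimes> h [^] (i::int) = h [^] (j::int) \<otimes> g"
  shows "g \<otimes> h [^] (i * t) = h [^] (j * t) \<otimes> g"
proof (induction t rule: int_induct[of _ 0])
  case base
  then show ?case using g by simp
next
  case (step1 t)
  have "g \<otimes> h [^] (i * (t + 1)) = g \<otimes> h [^] (i * t) \<otimes> h [^] i"
    using g by (simp add: distrib_left axis_pow_add m_assoc)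
  also have "\<dots> = h [^] (j * t) \<otimes> (h [^] j \<otimes> g)"
    using g by (simp add: step1 m_assoc ij)
  finally show ?case using g by (simp add: distrib_left axis_pow_add m_assoc)
next
  case (step2 t)
  have "h [^] j \<otimes> (g \<otimes> h [^] (- i)) = g \<otimes> h [^] i \<otimes> h [^] (- i)"
    using g by (simp add: ij m_assoc)
  also have "\<dots> = g" using g by (simp add: m_assoc axis_pow_add[symmetric])
  finally have "g \<otimes> h [^] (- i) = h [^] (- j) \<otimes> g"
    using g by (simp add: int_pow_neg inv_solve_left)
  moreover have "g \<otimes> h [^] (i * (t - 1)) = g \<otimes> h [^] (i * t) \<otimes> h [^] (- i)"
    using g axis_pow_add[of "i * t" "- i"] by (simp add: algebra_simps m_assoc)
  ultimately have "g \<otimes> h [^] (i * (t - 1)) = h [^] (j * t) \<otimes> (h [^] (- j) \<otimes> g)"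
    using g by (simp add: step2 m_assoc)
  then show ?case using g axis_pow_add[of "j * t" "- j"] by (simp add: algebra_simps m_assoc)
qed

lemma commensurator_unbounded:
  assumes "g \<in> commensurator"
  shows "\<exists>(m::int) (n::int). B < gp \<one> (g \<otimes> h [^] m) (h [^] n)"
proof -
  obtain i j :: int where ij: "i \<noteq> 0" "j \<noteq> 0" "g \<otimes> h [^] i = h [^] j \<otimes> g" and g: "g \<in> carrier G"
    using assms by (auto simp: commensurator_def)
  define t :: int where "t = max 0 (\<lceil>B + d \<one> g\<rceil> + 1)"
  have t: "0 \<le> t" "B + d \<one> g < t" unfolding t_def by linarith+
  have "1 \<le> \<bar>j\<bar>" using ij(2) by linarith
  then have "t \<le> \<bar>j\<bar> * t" using mult_right_mono[of 1 "\<bar>j\<bar>" t] t by simp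
  then have "t \<le> \<bar>j * t\<bar>" using t by (simp add: abs_mult)
  then have "t \<le> d \<one> (h [^] (j * t))" using axis_length[of "j * t"] by linarith
  moreover have "d (h [^] (j * t)) (g \<otimes> h [^] (i * t)) = d \<one> g"
    using intertwining_powers[OF g ij(3)] dist_mult_right g by simp
  ultimately have "B < gp \<one> (g \<otimes> h [^] (i * t)) (h [^] (j * t))"
    using gp_ge[of \<one> "h [^] (j * t)" "g \<otimes> h [^] (i * t)"] t g by (simp add: gp_commute)
  then show ?thesis by blast
qed

lemma common_offset:
  assumes "a \<in> carrier G" "b \<in> carrier G" "g \<in> carrier G" "x \<in> carrier G" "y \<in> carrier G"
    and eq: "inv a \<otimes> (g \<otimes> x) = inv b \<otimes> (g \<otimes> y)"
  shows "g \<otimes> (x \<otimes> inv y) = (a \<otimes> inv b) \<otimes> g"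
proof -
  have "g \<otimes> x = a \<otimes> (inv a \<otimes> (g \<otimes> x))" using assms(1-4) by (simp add: m_assoc[symmetric])
  also have "\<dots> = a \<otimes> (inv b \<otimes> (g \<otimes> y))" by (simp only: eq)
  also have "\<dots> = a \<otimes> inv b \<otimes> g \<otimes> y" using assms(1-5) by (simp add: m_assoc)
  finally have "g \<otimes> x \<otimes> inv y = a \<otimes> inv b \<otimes> g \<otimes> y \<otimes> inv y" by simp
  then show ?thesis using assms by (simp add: m_assoc)
qed

text \<open>
  If \<open>g h\<^sup>m\<close> and \<open>h\<^sup>n\<close> follow each other for a long time, then the translated axis passes within a fixed
  radius of many points \<open>h\<^sup>j\<close>. So the difference elements \<open>h\<^sup>-\<^sup>j g h\<^sup>i\<close> lie in a fixed finite ball,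
  two of them coincide, and this is an intertwining relation for \<open>g\<close>.
\<close>

lemma not_commensurator_bounded:
  assumes g: "g \<in> carrier G" "g \<notin> commensurator"
  shows "\<exists>B. \<forall>(m::int) (n::int). gp \<one> (g \<otimes> h [^] m) (h [^] n) \<le> B"
proof (rule ccontr)
  assume unb: "\<not> ?thesis"
  have \<delta>: "0 \<le> \<delta>" using delta_nonneg[of \<one>] by simp
  define ball where "ball = {x \<in> carrier G. d \<one> x \<le> axis_radius}"
  have fin: "finite ball" unfolding ball_def by (rule finite_balls)
  define j0 where "j0 = nat (\<lceil>d \<one> g + C + 2 * \<delta>\<rceil> + 1)"
  have j0: "d \<one> g + C + 2 * \<delta> < real j0" unfolding j0_def by linarith
  define J where "J = {j0..j0 + card ball}"
  \<comment> \<open>Products beyond \<open>T\<close> mean that the two rays agree past \<open>h\<^sup>j\<close> for all \<open>j\<close> in \<open>J\<close>, whose size exceeds that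
    of the ball; the points before \<open>j0\<close> are too close to \<open>g\<close> to be useful.\<close>
  define T where "T = real (j0 + card ball) * d \<one> h"
  obtain m n :: int where mn: "T < gp \<one> (g \<otimes> h [^] m) (h [^] n)" using unb by (meson not_le)
  define \<sigma> \<tau> :: int where "\<sigma> = (if 0 \<le> m then 1 else - 1)" and "\<tau> = (if 0 \<le> n then 1 else - 1)"
  have \<sigma>: "\<sigma> = 1 \<or> \<sigma> = - 1" "m = 0 + \<sigma> * int (nat \<bar>m\<bar>)" and \<tau>: "\<tau> = 1 \<or> \<tau> = - 1" "n = \<tau> * int (nat \<bar>n\<bar>)"
    by (auto simp: \<sigma>_def \<tau>_def)
  define y where "y = g \<otimes> h [^] m"
  have y: "y \<in> carrier G" using g by (simp add: y_def)
  have h1: "1 \<le> d \<one> h" using axis_length[of 1] by simp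
  have "T < \<bar>n\<bar> * d \<one> h"
    using mn gp_le[of \<one> "h [^] n" y] axis_length_le[of n] y by (simp add: gp_commute y_def)
  then have long: "int (j0 + card ball) < \<bar>n\<bar>"
    using h1 unfolding T_def by (simp add: mult_less_cancel_right)
  have "\<exists>i. inv (h [^] (\<tau> * int j)) \<otimes> (g \<otimes> h [^] (\<sigma> * int i)) \<in> ball" if "j \<in> J" for j
  proof -
    define w where "w = h [^] (\<tau> * int j)"
    have w: "w \<in> carrier G" by (simp add: w_def)
    have lenw: "real j \<le> d \<one> w" "d \<one> w \<le> j * d \<one> h"
      using axis_length[of "\<tau> * int j"] axis_length_le[of "\<tau> * int j"] \<tau>(1) by (auto simp: w_def)
    have "j * d \<one> h \<le> T" using that h1 unfolding T_def J_def by (intro mult_right_mono) auto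
    have "gp w \<one> (h [^] n) \<le> C"
    proof (cases "\<tau> = 1")
      case True
      then show ?thesis using axis_between[of 0 "int j" n] that \<tau>(2) long by (auto simp: w_def J_def)
    next
      case False
      then have "\<tau> = - 1" using \<tau>(1) by simp
      then show ?thesis using axis_between[of n "- int j" 0] that \<tau>(2) long
        by (auto simp: w_def J_def gp_commute)
    qed
    then have "d \<one> w - C \<le> gp \<one> w (h [^] n)" using gp_switch_base[of \<one> w "h [^] n"] by simp
    then have "d \<one> w - C - \<delta> \<le> gp \<one> w y"
      using four_point[of \<one> w "h [^] n" y] mn lenw \<open>j * d \<one> h \<le> T\<close> w y axis_nonneg
      by (auto simp: gp_commute y_def)
    then have "gp w \<one> y \<le> C + \<delta>" using gp_switch_base[of \<one> w y] by simp
    moreover have "d \<one> w - d \<one> g \<le> gp w \<one> g"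
      using gp_ge[of w \<one> g] w g by (simp add: commute)
    moreover have "real j0 \<le> real j" using that J_def by simp
    ultimately have "gp w g y \<le> C + 2 * \<delta>"
      using four_point[of w \<one> g y] w g y lenw j0 by auto
    then have "gp w (g \<otimes> h [^] (0::int)) (g \<otimes> h [^] (0 + \<sigma> * int (nat \<bar>m\<bar>))) \<le> C + 2 * \<delta>"
      using \<sigma>(2) g by (simp add: y_def)
    then obtain i where "d w (g \<otimes> h [^] (0 + \<sigma> * int i)) \<le> axis_radius"
      using axis_passes_near[OF \<sigma>(1) g(1) w] by blast
    then show ?thesis
      using dist_eq_length[of w "g \<otimes> h [^] (\<sigma> * int i)"] w g by (auto simp: ball_def w_def)
  qed
  then obtain i where i: "\<And>j. j \<in> J \<Longrightarrow> inv (h [^] (\<tau> * int j)) \<otimes> (g \<otimes> h [^] (\<sigma> * int (i j))) \<in> ball"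
    by metis
  define \<phi> where "\<phi> j = inv (h [^] (\<tau> * int j)) \<otimes> (g \<otimes> h [^] (\<sigma> * int (i j)))" for j
  have "\<phi> ` J \<subseteq> ball" using i by (auto simp: \<phi>_def)
  then have "card (\<phi> ` J) \<le> card ball" by (rule card_mono[OF fin])
  also have "\<dots> < card J" by (simp add: J_def)
  finally have "card (\<phi> ` J) < card J" .
  then obtain j j' where jj: "j \<in> J" "j' \<in> J" "j \<noteq> j'" "\<phi> j = \<phi> j'"
    using pigeonhole unfolding inj_on_def by blast
  define r s where "r = \<sigma> * int (i j) - \<sigma> * int (i j')" and "s = \<tau> * int j - \<tau> * int j'"
  have eq: "g \<otimes> h [^] r = h [^] s \<otimes> g"
    using common_offset[of "h [^] (\<tau> * int j)" "h [^] (\<tau> * int j')" g "h [^] (\<sigma> * int (i j))" "h [^] (\<sigma> * int (i j'))"]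
      jj(4) g by (simp add: \<phi>_def r_def s_def int_pow_diff)
  have "s \<noteq> 0" using jj(3) \<tau>(1) by (auto simp: s_def)
  moreover have "r \<noteq> 0"
  proof
    assume "r = 0"
    then have "h [^] s = \<one>" using eq g by simp
    then show False using axis_inj[of s 0] \<open>s \<noteq> 0\<close> by simp
  qed
  ultimately show False using eq g by (auto simp: commensurator_def)
qed

text \<open>
  The translated axis through \<open>g\<close> has both ends in common with the axis of \<open>h\<close>: far out in both
  directions, \<open>g h\<^sup>i\<close> and \<open>h\<^sup>j\<close> are at distance at most the length of \<open>g\<close>. Since \<open>g\<close> lies almost between the far
  points of its own axis, it lies almost between those of the axis of \<open>h\<close>. The radius does not
  depend on \<open>g\<close>, which is what makes the index of the powers of \<open>h\<close> finite.
\<close>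

lemma commensurator_near_axis:
  assumes "g \<in> commensurator"
  shows "\<exists>s::int. d g (h [^] s) \<le> axis_radius"
proof -
  obtain i j :: int where ij: "i \<noteq> 0" "j \<noteq> 0" "g \<otimes> h [^] i = h [^] j \<otimes> g" and g: "g \<in> carrier G"
    using assms by (auto simp: commensurator_def)
  define t :: int where "t = \<lceil>2 * d \<one> g + C + 2 * \<delta>\<rceil> + 1"
  have \<delta>: "0 \<le> \<delta>" using delta_nonneg[of \<one>] by simp
  have t: "0 \<le> t" "2 * d \<one> g + C + 2 * \<delta> < t"
    unfolding t_def using \<delta> axis_nonneg nonneg[of \<one> g] by linarith+
  define P where "P k = h [^] (j * k)" for k
  define Q where "Q k = g \<otimes> h [^] (i * k)" for k
  have PQ: "P k \<in> carrier G" "Q k \<in> carrier G" "d (P k) (Q k) = d \<one> g" for k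
    using intertwining_powers[OF g ij(3)] dist_mult_right g by (simp_all add: P_def Q_def)
  have far: "C + 2 * \<delta> < gp g (Q k) (P k)" if "\<bar>k\<bar> = t" for k
  proof -
    have "1 \<le> \<bar>j\<bar>" using ij(2) by linarith
    then have "\<bar>k\<bar> \<le> \<bar>j\<bar> * \<bar>k\<bar>" using mult_right_mono[of 1 "\<bar>j\<bar>" "\<bar>k\<bar>"] by simp
    then have "real_of_int \<bar>k\<bar> \<le> real_of_int \<bar>j * k\<bar>" by (simp only: of_int_le_iff abs_mult)
    then have "t \<le> d \<one> (P k)" using axis_length[of "j * k"] that by (simp add: P_def)
    then show ?thesis
      using gp_ge[of g "P k" "Q k"] triangle[of \<one> g "P k"] PQ[of k] t g by (simp add: gp_commute)
  qed
  have "gp g (Q t) (Q (- t)) \<le> C"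
  proof -
    have "gp \<one> (h [^] (i * t)) (h [^] (i * - t)) \<le> C"
      using axis_opposite[of "i * t" "i * - t"] axis_opposite[of "i * - t" "i * t"] t
      by (cases "0 \<le> i") (auto simp: gp_commute mult_nonneg_nonneg mult_nonpos_nonneg)
    then show ?thesis using gp_translate[of g \<one> "h [^] (i * t)" "h [^] (i * - t)"] g
      by (simp add: Q_def)
  qed
  then have "gp g (Q t) (P (- t)) \<le> C + \<delta>"
    using four_point[of g "Q t" "P (- t)" "Q (- t)"] far[of "- t"] t g PQ \<delta> by (auto simp: gp_commute)
  then have near: "gp g (P t) (P (- t)) \<le> C + 2 * \<delta>"
    using four_point[of g "Q t" "P t" "P (- t)"] far[of t] t g PQ \<delta> by auto
  define K where "K = \<bar>j\<bar> * t"
  have "gp g (\<one> \<otimes> h [^] (- K)) (\<one> \<otimes> h [^] (- K + 1 * int (nat (2 * K)))) \<le> C + 2 * \<delta>"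
  proof (cases "0 \<le> j")
    case True
    then show ?thesis using near t by (simp add: K_def P_def gp_commute)
  next
    case False
    then show ?thesis using near t by (simp add: K_def P_def mult_nonpos_nonneg)
  qed
  then show ?thesis using axis_passes_near[of 1 \<one> g "- K" "nat (2 * K)"] g by auto
qed

lemma commensurator_subgroup: "subgroup commensurator G"
proof (rule subgroupI)
  show "commensurator \<subseteq> carrier G" by (auto simp: commensurator_def)
  show "commensurator \<noteq> {}"
    unfolding commensurator_def by (auto intro!: exI[of _ \<one>] exI[of _ "1::int"])
next
  fix g assume "g \<in> commensurator"
  then obtain i j :: int where ij: "i \<noteq> 0" "j \<noteq> 0" "g \<otimes> h [^] i = h [^] j \<otimes> g" and g: "g \<in> carrier G"
    by (auto simp: commensurator_def)
  have "inv g \<otimes> (g \<otimes> h [^] i) \<otimes> inv g = inv g \<otimes> (h [^] j \<otimes> g) \<otimes> inv g" using ij(3) by simp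
  then have "inv g \<otimes> h [^] j = h [^] i \<otimes> inv g" using g by (simp add: m_assoc mult_inv_cancel)
  then show "inv g \<in> commensurator" using ij g by (auto simp: commensurator_def)
next
  fix a b assume "a \<in> commensurator" "b \<in> commensurator"
  then obtain i j k l :: int where a: "i \<noteq> 0" "j \<noteq> 0" "a \<otimes> h [^] i = h [^] j \<otimes> a" "a \<in> carrier G"
    and b: "k \<noteq> 0" "l \<noteq> 0" "b \<otimes> h [^] k = h [^] l \<otimes> b" "b \<in> carrier G"
    by (auto simp: commensurator_def)
  have "a \<otimes> b \<otimes> h [^] (k * i) = a \<otimes> (h [^] (i * l) \<otimes> b)"
    using intertwining_powers[OF b(4,3), of i] a b by (simp add: m_assoc mult.commute)
  also have "\<dots> = a \<otimes> h [^] (i * l) \<otimes> b" using a b by (simp add: m_assoc)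
  also have "\<dots> = h [^] (j * l) \<otimes> (a \<otimes> b)"
    using intertwining_powers[OF a(4,3), of l] a b by (simp add: m_assoc)
  finally have "a \<otimes> b \<otimes> h [^] (k * i) = h [^] (j * l) \<otimes> (a \<otimes> b)" .
  moreover have "k * i \<noteq> 0" "j * l \<noteq> 0" using a b by auto
  ultimately show "a \<otimes> b \<in> commensurator" using a b unfolding commensurator_def by blast
qed

lemma commensurator_all_imp_virtually_cyclic:
  assumes all: "commensurator = carrier G"
  shows "virtually_cyclic G"
proof -
  define H where "H = range (\<lambda>n::int. h [^] n)"
  have Heq: "H = generate G {h}" using generate_pow[of h] by (auto simp: H_def)
  have sub: "subgroup H G" unfolding Heq by (rule generate_is_subgroup) simp
  define ball where "ball = {x \<in> carrier G. d \<one> x \<le> axis_radius}"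
  have "rcosets H \<subseteq> (\<lambda>b. H #> b) ` ball"
  proof
    fix Y assume "Y \<in> rcosets H"
    then obtain g where g: "g \<in> carrier G" "Y = H #> g" by (auto simp: RCOSETS_def)
    then obtain s :: int where s: "d g (h [^] s) \<le> axis_radius"
      using commensurator_near_axis all by blast
    define b where "b = inv (h [^] s) \<otimes> g"
    have "b \<in> ball" using s g dist_eq_length[of "h [^] s" g]
      by (simp add: ball_def b_def commute)
    moreover have "H #> b = Y"
      using coset_join2[of "inv (h [^] s)" H] sub subgroup.m_inv_closed[OF sub, of "h [^] s"] g
        coset_mult_assoc[of H "inv (h [^] s)" g] subgroup.subset[OF sub] by (simp add: b_def H_def)
    ultimately show "Y \<in> (\<lambda>b. H #> b) ` ball" by blast
  qed
  then have "finite (rcosets H)"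
    using finite_balls finite_subset unfolding ball_def by blast
  moreover have "cyclic_group (G\<lparr>carrier := H\<rparr>)"
  proof -
    interpret H: group "G\<lparr>carrier := H\<rparr>" using subgroup_imp_group[OF sub] .
    have "h \<in> H" unfolding H_def using int_pow_1[of h] by (metis axis_mem rangeI)
    moreover have "h [^]\<^bsub>G\<lparr>carrier := H\<rparr>\<^esub> n = h [^] n" for n :: int
      using int_pow_consistent[OF sub \<open>h \<in> H\<close>] by simp
    ultimately show ?thesis unfolding H.cyclic_group by (intro bexI[of _ h]) (simp_all add: H_def)
  qed
  ultimately show ?thesis using sub unfolding virtually_cyclic_def by blast
qed

end
end

section \<open>Long elements with independent directions\<close>

lemma uniform_bound:
  fixes P :: "'i \<Rightarrow> real \<Rightarrow> bool"
  assumes "finite I" "\<And>i. i \<in> I \<Longrightarrow> \<exists>D. P i D" "\<And>i D E. P i D \<Longrightarrow> D \<le> E \<Longrightarrow> P i E"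
  shows "\<exists>D. \<forall>i\<in>I. P i D"
proof -
  obtain D where D: "\<And>i. i \<in> I \<Longrightarrow> P i (D i)" using assms(2) by metis
  have "P i (Max (D ` I))" if "i \<in> I" for i
    using assms(1) that by (intro assms(3)[OF D]) auto
  then show ?thesis by blast
qed

context hyperbolic_group begin

text \<open>
  The pairs \<open>\<phi> (2 c), \<phi> (2 c + 1)\<close> are the two elements that belong to the colour \<open>c\<close>. They have their
  own bound \<open>C\<close>, to be fixed before the number \<open>N\<close> of elements is known, while \<open>D\<close> may depend on \<open>N\<close>.
  The case \<open>m = n\<close> is missing from the last condition: a translate \<open>z \<phi>\<^sub>n\<close> may well follow \<open>\<phi>\<^sub>n\<close>,
  for instance if \<open>z\<close> lies in a finite normal subgroup.
\<close>

definition spread_family :: "real \<Rightarrow> real \<Rightarrow> real \<Rightarrow> 'a set \<Rightarrow> nat \<Rightarrow> (nat \<Rightarrow> 'a) \<Rightarrow> bool" where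
  "spread_family C D L Z N \<phi> \<longleftrightarrow> range \<phi> \<subseteq> carrier G \<and> (\<forall>n<N. L \<le> d \<one> (\<phi> n)) \<and>
    (\<forall>c. 2 * c + 1 < N \<longrightarrow> gp \<one> (inv (\<phi> (2 * c))) (inv (\<phi> (2 * c + 1))) \<le> C) \<and>
    (\<forall>m<N. \<forall>n<N. \<forall>z\<in>Z. gp \<one> (z \<otimes> inv (\<phi> m)) (\<phi> n) \<le> D) \<and>
    (\<forall>m<N. \<forall>n<N. m \<noteq> n \<longrightarrow>
      (\<forall>z\<in>Z. gp \<one> (z \<otimes> \<phi> m) (\<phi> n) \<le> D) \<and> gp \<one> (inv (\<phi> m)) (inv (\<phi> n)) \<le> D)"

lemma spread_family_mono: "spread_family C D L Z N \<phi> \<Longrightarrow> D \<le> E \<Longrightarrow> spread_family C E L Z N \<phi>"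
  unfolding spread_family_def by (meson order_trans)

context
  fixes h C g B
  assumes ax: "quasi_axis h C" and g: "g \<in> carrier G" "g \<notin> commensurator h"
    and B: "\<And>(m::int) (n::int). gp \<one> (g \<otimes> h [^] m) (h [^] n) \<le> B"
begin

lemma h_mem [simp]: "h \<in> carrier G" by (rule axis_mem[OF ax])

text \<open>
  For a high power \<open>v\<close> of \<open>h\<^sup>r\<close>, the points \<open>v g h\<^sup>m\<close> all lie in the direction of \<open>v\<close>, which the points
  \<open>g h\<^sup>n\<close> avoid. So \<open>g\<inverse> v g\<close> moves the ends of the axis away from themselves.
\<close>

lemma conjugate_power_not_commensurator:
  fixes r :: int
  assumes r: "inv g \<otimes> (h [^] r \<otimes> g) \<in> commensurator h"
  shows "r = 0"
proof (rule ccontr)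
  assume "r \<noteq> 0"
  have pow: "inv g \<otimes> (h [^] (r * int s) \<otimes> g) \<in> commensurator h" for s
  proof (induction s)
    case 0
    then show ?case using g subgroup.one_closed[OF commensurator_subgroup[OF ax]] by simp
  next
    case (Suc s)
    have "inv g \<otimes> (h [^] (r * int (Suc s)) \<otimes> g)
        = inv g \<otimes> (h [^] r \<otimes> g) \<otimes> (inv g \<otimes> (h [^] (r * int s) \<otimes> g))"
    proof -
      have "g \<otimes> (inv g \<otimes> (h [^] (r * int s) \<otimes> g)) = h [^] (r * int s) \<otimes> g"
        using g by (simp add: m_assoc[symmetric])
      then show ?thesis
        using g axis_pow_add[OF ax, of r "r * int s"] by (simp add: distrib_left m_assoc)
    qed
    then show ?case using Suc r subgroup.m_closed[OF commensurator_subgroup[OF ax]] by simp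
  qed
  define s where "s = nat (\<lceil>2 * B + \<delta>\<rceil> + 1)"
  have s: "2 * B + \<delta> < real s" unfolding s_def by linarith
  define v where "v = h [^] (r * int s)"
  have v: "v \<in> carrier G" by (simp add: v_def)
  have "1 \<le> \<bar>r\<bar>" using \<open>r \<noteq> 0\<close> by linarith
  then have "int s \<le> \<bar>r * int s\<bar>" using mult_right_mono[of 1 "\<bar>r\<bar>" "int s"] by (simp add: abs_mult)
  then have lenv: "2 * B + \<delta> < d \<one> v" using axis_length[OF ax, of "r * int s"] s unfolding v_def by linarith
  define k where "k = inv g \<otimes> (v \<otimes> g)"
  have k: "k \<in> commensurator h" "k \<in> carrier G" "g \<otimes> k = v \<otimes> g"
    using pow[of s] g v by (simp_all add: k_def v_def m_assoc[symmetric])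
  obtain m n :: int where mn: "B + \<delta> + d \<one> g < gp \<one> (k \<otimes> h [^] m) (h [^] n)"
    using commensurator_unbounded[OF ax k(1)] by blast
  define x where "x = v \<otimes> (g \<otimes> h [^] m)"
  define y where "y = g \<otimes> h [^] n"
  have xy: "x \<in> carrier G" "y \<in> carrier G" using g v by (auto simp: x_def y_def)
  have "gp \<one> (k \<otimes> h [^] m) (h [^] n) = gp g x y"
    using gp_translate[of g \<one> "k \<otimes> h [^] m" "h [^] n"] k g v by (simp add: m_assoc[symmetric] x_def y_def)
  also have "\<dots> \<le> gp \<one> x y + d \<one> g"
    using gp_change_base[of g \<one> x y] g xy by (simp add: commute)
  finally have big: "B + \<delta> < gp \<one> x y" using mn by simp
  have "gp v \<one> x = gp \<one> (inv v) (g \<otimes> h [^] m)"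
    using gp_at[of v \<one> x] v g by (simp add: x_def mult_inv_cancel)
  also have "inv v = h [^] (- (r * int s))" by (simp add: v_def int_pow_neg)
  finally have "d \<one> v - B \<le> gp \<one> v x"
    using gp_switch_base[of \<one> v x] B[of m "- (r * int s)"] by (simp add: gp_commute)
  then have "gp \<one> v y > B"
    using four_point[of \<one> v x y] big lenv v xy by (auto simp: min_def split: if_splits)
  then show False using B[of n "r * int s"] by (simp add: v_def y_def gp_commute)
qed

text \<open>
  The axis of \<open>h\<close> translated by \<open>dir \<beta>\<close> contains a point whose distance to \<open>h\<^sup>\<beta>\<close> is the length of \<open>g\<close>, and
  from there its two rays diverge from the axis of \<open>h\<close>.
\<close>

definition dir :: "int \<Rightarrow> 'a" where "dir \<beta> = h [^] \<beta> \<otimes> g"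

lemma dir_mem [simp]: "dir \<beta> \<in> carrier G" using g by (simp add: dir_def)

text \<open>
  An element \<open>z\<close> carries at most one of the translated axes to the axis with index \<open>\<beta>\<close> in the sense of the
  commensurator, because two of them would differ by some \<open>g\<inverse> h\<^sup>r g\<close> in the commensurator.
\<close>

lemma transporter_unique:
  assumes z: "z \<in> carrier G" and "inv (dir \<beta>) \<otimes> (z \<otimes> dir \<alpha>) \<in> commensurator h"
    and "inv (dir \<beta>) \<otimes> (z \<otimes> dir \<alpha>') \<in> commensurator h"
  shows "\<alpha> = \<alpha>'"
proof -
  define u where "u = inv (dir \<beta>) \<otimes> z"
  have u: "u \<in> carrier G" using z by (simp add: u_def)
  have "inv (u \<otimes> dir \<alpha>) \<otimes> (u \<otimes> dir \<alpha>') \<in> commensurator h"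
    using assms subgroup.m_closed[OF commensurator_subgroup[OF ax]]
      subgroup.m_inv_closed[OF commensurator_subgroup[OF ax]] by (simp add: u_def m_assoc)
  also have "inv (u \<otimes> dir \<alpha>) \<otimes> (u \<otimes> dir \<alpha>') = inv (dir \<alpha>) \<otimes> dir \<alpha>'"
    using u by (simp add: inv_mult_group m_assoc mult_inv_cancel)
  also have "\<dots> = inv g \<otimes> (h [^] (\<alpha>' - \<alpha>) \<otimes> g)"
    using g axis_pow_add[OF ax, of "- \<alpha>" \<alpha>'] by (simp add: dir_def inv_mult_group m_assoc int_pow_neg)
  finally show ?thesis using conjugate_power_not_commensurator by force
qed

text \<open>
  Each index rules out only finitely many others, so a greedy choice succeeds. The sets \<open>A n\<close> leave
  room for sign conditions on the indices.
\<close>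

lemma independent_directions:
  assumes Z: "finite Z" "Z \<subseteq> carrier G" "\<And>z. z \<in> Z \<Longrightarrow> inv z \<in> Z"
    and A: "\<And>n. infinite (A n)"
  shows "\<exists>s::nat \<Rightarrow> int. (\<forall>n. s n \<in> A n) \<and>
    (\<forall>m n. m \<noteq> n \<longrightarrow> (\<forall>z\<in>Z. inv (dir (s m)) \<otimes> (z \<otimes> dir (s n)) \<notin> commensurator h))"
proof -
  define bad where "bad \<beta> = (\<Union>z\<in>Z. {\<alpha>. inv (dir \<beta>) \<otimes> (z \<otimes> dir \<alpha>) \<in> commensurator h})" for \<beta>
  have fin: "finite (bad \<beta>)" for \<beta>
  proof -
    have "finite {\<alpha>. inv (dir \<beta>) \<otimes> (z \<otimes> dir \<alpha>) \<in> commensurator h}" if "z \<in> Z" for z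
    proof (cases "\<exists>\<alpha>. inv (dir \<beta>) \<otimes> (z \<otimes> dir \<alpha>) \<in> commensurator h")
      case True
      then obtain \<alpha> where "inv (dir \<beta>) \<otimes> (z \<otimes> dir \<alpha>) \<in> commensurator h" by blast
      then have "{\<alpha>. inv (dir \<beta>) \<otimes> (z \<otimes> dir \<alpha>) \<in> commensurator h} \<subseteq> {\<alpha>}"
        using transporter_unique that Z(2) by blast
      then show ?thesis using finite_subset by blast
    qed simp
    then show ?thesis using Z(1) by (simp add: bad_def)
  qed
  have "\<exists>s::nat \<Rightarrow> int. \<forall>n. s n \<in> A n \<and> (\<forall>m<n. s n \<notin> bad (s m))"
  proof (rule dependent_wellorder_choice)
    fix n and f :: "nat \<Rightarrow> int"
    have "infinite (A n - (\<Union>m<n. bad (f m)))" using A[of n] fin by (simp add: Diff_infinite_finite)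
    then have "A n - (\<Union>m<n. bad (f m)) \<noteq> {}" by force
    then show "\<exists>r. r \<in> A n \<and> (\<forall>m<n. r \<notin> bad (f m))" by auto
  qed simp
  then obtain s :: "nat \<Rightarrow> int" where s: "\<And>n. s n \<in> A n" "\<And>m n. m < n \<Longrightarrow> s n \<notin> bad (s m)" by blast
  have "inv (dir (s m)) \<otimes> (z \<otimes> dir (s n)) \<notin> commensurator h" if "m \<noteq> n" "z \<in> Z" for m n z
  proof
    assume c: "inv (dir (s m)) \<otimes> (z \<otimes> dir (s n)) \<in> commensurator h"
    show False
    proof (cases "m < n")
      case True
      then show False using s(2)[of m n] c that by (auto simp: bad_def)
    next
      case False
      then have "n < m" using that by simp
      have "inv (inv (dir (s m)) \<otimes> (z \<otimes> dir (s n))) \<in> commensurator h"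
        using c subgroup.m_inv_closed[OF commensurator_subgroup[OF ax]] by blast
      then have "inv (dir (s n)) \<otimes> (inv z \<otimes> dir (s m)) \<in> commensurator h"
        using that Z(2) by (simp add: inv_mult_group m_assoc subset_iff)
      then show False using s(2)[OF \<open>n < m\<close>] Z(3)[OF that(2)] by (auto simp: bad_def)
    qed
  qed
  then show ?thesis using s(1) by blast
qed

lemma directions_diverge:
  assumes z: "z \<in> carrier G" and "inv (dir \<beta>) \<otimes> (z \<otimes> dir \<alpha>) \<notin> commensurator h"
  shows "\<exists>D. \<forall>(a::int) (b::int). gp \<one> (z \<otimes> (dir \<alpha> \<otimes> h [^] a)) (dir \<beta> \<otimes> h [^] b) \<le> D"
proof -
  define w where "w = inv (dir \<beta>) \<otimes> (z \<otimes> dir \<alpha>)"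
  have w: "w \<in> carrier G" "dir \<beta> \<otimes> w = z \<otimes> dir \<alpha>" using z by (simp_all add: w_def m_assoc[symmetric])
  obtain D where D: "\<And>(a::int) (b::int). gp \<one> (w \<otimes> h [^] a) (h [^] b) \<le> D"
    using not_commensurator_bounded[OF ax w(1)] assms(2) w_def by blast
  have "gp \<one> (z \<otimes> (dir \<alpha> \<otimes> h [^] a)) (dir \<beta> \<otimes> h [^] b) \<le> D + d \<one> (dir \<beta>)" for a b :: int
  proof -
    have "z \<otimes> (dir \<alpha> \<otimes> h [^] a) = dir \<beta> \<otimes> (w \<otimes> h [^] a)"
      using w z by (simp add: m_assoc[symmetric])
    then show ?thesis
      using gp_translate[of "dir \<beta>" \<one> "w \<otimes> h [^] a" "h [^] b"] w D[of a b]
        gp_change_base[of \<one> "dir \<beta>" "dir \<beta> \<otimes> (w \<otimes> h [^] a)" "dir \<beta> \<otimes> h [^] b"] by simp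
  qed
  then show ?thesis by blast
qed

text \<open>
  Inverses of the elements \<open>h\<^sup>\<alpha> g h\<^sup>n g\<inverse> h\<^sup>-\<^sup>\<beta>\<close> follow \<open>h\<^sup>\<beta>\<close> up to an error that depends neither on \<open>\<alpha>\<close> nor
  on \<open>\<beta>\<close>. This is the reason why the pair bound is uniform.
\<close>

lemma direction_follows_axis:
  assumes M: "d \<one> g + d \<one> (dir \<alpha>) + B + \<delta> < M"
  shows "d \<one> (h [^] \<beta>) - B - \<delta> \<le> gp \<one> (h [^] \<beta>) (dir \<beta> \<otimes> h [^] (- int M) \<otimes> inv (dir \<alpha>))"
proof -
  define x where "x = g \<otimes> h [^] (- int M)"
  define y where "y = x \<otimes> inv (dir \<alpha>)"
  have xy: "x \<in> carrier G" "y \<in> carrier G" using g by (auto simp: x_def y_def)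
  have "real M \<le> d \<one> (h [^] (- int M))" using axis_length[OF ax, of "- int M"] by simp
  then have "real M - d \<one> g \<le> d \<one> x"
    using length_mult_ge(1)[of g "h [^] (- int M)"] g by (simp add: x_def)
  moreover have "d x y = d \<one> (dir \<alpha>)"
    using dist_mult_right[of x "inv (dir \<alpha>)"] xy by (simp add: y_def length_inv)
  ultimately have "B + \<delta> < gp \<one> y x" using gp_ge[of \<one> x y] xy M by (simp add: gp_commute)
  moreover have "gp \<one> (h [^] (- \<beta>)) x \<le> B" using B[of "- int M" "- \<beta>"] by (simp add: x_def gp_commute)
  ultimately have "gp \<one> (h [^] (- \<beta>)) y \<le> B + \<delta>"
    using four_point[of \<one> "h [^] (- \<beta>)" y x] xy by auto
  moreover have "gp (h [^] \<beta>) \<one> (h [^] \<beta> \<otimes> y) = gp \<one> (h [^] (- \<beta>)) y"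
    using gp_at[of "h [^] \<beta>" \<one> "h [^] \<beta> \<otimes> y"] xy by (simp add: mult_inv_cancel int_pow_neg)
  moreover have "dir \<beta> \<otimes> h [^] (- int M) \<otimes> inv (dir \<alpha>) = h [^] \<beta> \<otimes> y"
    using g by (simp add: x_def y_def dir_def m_assoc)
  ultimately show ?thesis using gp_switch_base[of \<one> "h [^] \<beta>" "h [^] \<beta> \<otimes> y"] by simp
qed

text \<open>
  The bound \<open>C + 2 * \<delta>\<close> for pairs depends only on the axis, and \<open>L\<close> is chosen after \<open>D\<close>.
\<close>

lemma independent_family:
  assumes Z: "finite Z" "Z \<subseteq> carrier G" "\<And>z. z \<in> Z \<Longrightarrow> inv z \<in> Z" "\<one> \<in> Z"
  shows "\<exists>D. \<forall>L. \<exists>\<phi>. spread_family (C + 2 * \<delta>) D L Z N \<phi>"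
proof -
  have \<delta>: "0 \<le> \<delta>" using delta_nonneg[of \<one>] by simp
  \<comment> \<open>Beyond \<open>b0\<close> the power \<open>h\<^sup>\<beta>\<close> is long enough to separate the elements of a pair.\<close>
  define b0 :: int where "b0 = max 0 (\<lceil>B + C + 3 * \<delta>\<rceil> + 1)"
  have b0: "0 \<le> b0" "B + C + 3 * \<delta> < b0" unfolding b0_def by linarith+
  \<comment> \<open>The index \<open>\<beta> n = s (2 n + 1)\<close> is to be positive for even \<open>n\<close> and negative for odd \<open>n\<close>.\<close>
  define A where "A n = (if n mod 4 = 1 then {b0..} else {..- b0})" for n :: nat
  have A: "infinite (A n)" for n by (simp add: A_def infinite_Ici infinite_Iic)
  obtain s :: "nat \<Rightarrow> int" where s: "\<And>n. s n \<in> A n"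
    "\<And>m n z. m \<noteq> n \<Longrightarrow> z \<in> Z \<Longrightarrow> inv (dir (s m)) \<otimes> (z \<otimes> dir (s n)) \<notin> commensurator h"
    using independent_directions[of Z A, OF Z(1,2)] Z(3) A by metis
  define \<alpha> \<beta> where "\<alpha> n = s (2 * n)" and "\<beta> n = s (2 * n + 1)" for n
  define I where "I = {..<2*N} \<times> {..<2*N} \<times> Z"
  have "\<exists>D. \<forall>(i,j,z)\<in>I. i \<noteq> j \<longrightarrow>
      (\<forall>(a::int) (b::int). gp \<one> (z \<otimes> (dir (s i) \<otimes> h [^] a)) (dir (s j) \<otimes> h [^] b) \<le> D)"
  proof (rule uniform_bound)
    show "finite I" using Z(1) by (simp add: I_def)
    fix t assume "t \<in> I"
    then obtain i j z where t: "t = (i, j, z)" "z \<in> Z" by (auto simp: I_def)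
    then show "\<exists>D. case t of (i, j, z) \<Rightarrow> i \<noteq> j \<longrightarrow>
        (\<forall>(a::int) (b::int). gp \<one> (z \<otimes> (dir (s i) \<otimes> h [^] a)) (dir (s j) \<otimes> h [^] b) \<le> D)"
      using directions_diverge[of z "s j" "s i"] s(2)[of j i z] Z(2) by (cases "i = j") auto
  qed (auto intro: order_trans)
  then obtain D1 where D1: "\<And>i j z a b. i < 2*N \<Longrightarrow> j < 2*N \<Longrightarrow> z \<in> Z \<Longrightarrow> i \<noteq> j \<Longrightarrow>
      gp \<one> (z \<otimes> (dir (s i) \<otimes> h [^] (a::int))) (dir (s j) \<otimes> h [^] (b::int)) \<le> D1"
    unfolding I_def by blast
  have "\<exists>T. \<forall>i\<in>{..<2*N}. d \<one> (dir (s i)) \<le> T" by (rule uniform_bound) auto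
  then obtain T where T: "\<And>i. i < 2*N \<Longrightarrow> d \<one> (dir (s i)) \<le> T" by blast
  have key: "gp \<one> (z \<otimes> (dir (s i) \<otimes> h [^] a \<otimes> inv (dir (s i')))) (dir (s j) \<otimes> h [^] b \<otimes> inv (dir (s j'))) \<le> D1 + 2 * T"
    if "i < 2*N" "j < 2*N" "i' < 2*N" "j' < 2*N" "z \<in> Z" "i \<noteq> j" for i j i' j' z and a b :: int
    using gp_mult_right_le[of "z \<otimes> (dir (s i) \<otimes> h [^] a)" "dir (s j) \<otimes> h [^] b" "inv (dir (s i'))" "inv (dir (s j'))"]
      D1[OF that(1,2,5,6), of a b] T[OF that(3)] T[OF that(4)] that(5) Z(2)
    by (auto simp: m_assoc length_inv subset_iff)
  have "\<exists>\<phi>. spread_family (C + 2 * \<delta>) (D1 + 2 * T) L Z N \<phi>" for L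
  proof -
    define M where "M = nat (\<lceil>max (L + 2 * T) (d \<one> g + T + B + \<delta>)\<rceil> + 1)"
    have M: "L + 2 * T < M" "d \<one> g + T + B + \<delta> < M" unfolding M_def by linarith+
    define \<phi> where "\<phi> n = dir (\<alpha> n) \<otimes> h [^] (int M) \<otimes> inv (dir (\<beta> n))" for n
    have \<phi>: "\<phi> n \<in> carrier G" for n by (simp add: \<phi>_def)
    have inv\<phi>: "inv (\<phi> n) = dir (\<beta> n) \<otimes> h [^] (- int M) \<otimes> inv (dir (\<alpha> n))" for n
      by (simp add: \<phi>_def inv_mult_group m_assoc int_pow_neg)
    have len: "L \<le> d \<one> (\<phi> n)" if "n < N" for n
    proof -
      have "d \<one> (h [^] (int M)) - d \<one> (dir (\<alpha> n)) - d \<one> (dir (\<beta> n)) \<le> d \<one> (\<phi> n)"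
        using length_mult_ge(1)[of "dir (\<alpha> n)" "h [^] (int M)"]
          length_mult_ge(2)[of "dir (\<alpha> n) \<otimes> h [^] (int M)" "inv (dir (\<beta> n))"]
        by (simp add: \<phi>_def length_inv)
      moreover have "d \<one> (dir (\<alpha> n)) \<le> T" "d \<one> (dir (\<beta> n)) \<le> T"
        using T[of "2 * n"] T[of "2 * n + 1"] that by (auto simp: \<alpha>_def \<beta>_def)
      ultimately show ?thesis using axis_length[OF ax, of "int M"] M by simp
    qed
    have pair: "gp \<one> (inv (\<phi> (2 * c))) (inv (\<phi> (2 * c + 1))) \<le> C + 2 * \<delta>" if c: "2 * c + 1 < N" for c
    proof -
      define x y where "x = inv (\<phi> (2 * c))" and "y = inv (\<phi> (2 * c + 1))"
      define i j where "i = \<beta> (2 * c)" and "j = \<beta> (2 * c + 1)"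
      have xy: "x \<in> carrier G" "y \<in> carrier G" using \<phi> by (auto simp: x_def y_def)
      have "(2 * (2 * c) + 1) mod 4 = 1" "(2 * (2 * c + 1) + 1) mod 4 = 3" by presburger+
      then have ij: "b0 \<le> i" "j \<le> - b0"
        using s(1)[of "2 * (2 * c) + 1"] s(1)[of "2 * (2 * c + 1) + 1"]
        by (auto simp: i_def j_def \<beta>_def A_def)
      have tails: "d \<one> (dir (\<alpha> (2 * c))) \<le> T" "d \<one> (dir (\<alpha> (2 * c + 1))) \<le> T"
        using T[of "2 * (2 * c)"] T[of "2 * (2 * c + 1)"] c by (auto simp: \<alpha>_def)
      have "d \<one> (h [^] i) - B - \<delta> \<le> gp \<one> (h [^] i) x"
        unfolding x_def inv\<phi> i_def by (rule direction_follows_axis) (use tails M in linarith)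
      moreover have "d \<one> (h [^] j) - B - \<delta> \<le> gp \<one> (h [^] j) y"
        unfolding y_def inv\<phi> j_def by (rule direction_follows_axis) (use tails M in linarith)
      moreover have "b0 \<le> d \<one> (h [^] i)" "b0 \<le> d \<one> (h [^] j)"
        using axis_length[OF ax, of i] axis_length[OF ax, of j] ij b0(1) by linarith+
      ultimately have ends: "C + 2 * \<delta> < gp \<one> (h [^] i) x" "C + 2 * \<delta> < gp \<one> (h [^] j) y"
        using b0(2) by linarith+
      have "gp \<one> (h [^] j) (h [^] i) \<le> C" using axis_opposite[OF ax, of j i] ij b0(1) by simp
      then have "gp \<one> (h [^] i) y \<le> C + \<delta>"
        using four_point[of \<one> "h [^] i" y "h [^] j"] ends xy \<delta> by (auto simp: gp_commute)
      then show ?thesis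
        using four_point[of \<one> "h [^] i" x y] ends xy \<delta> by (auto simp: x_def y_def)
    qed
    have "gp \<one> (z \<otimes> inv (\<phi> m)) (\<phi> n) \<le> D1 + 2 * T" if "m < N" "n < N" "z \<in> Z" for m n z
    proof -
      have "2 * m + 1 \<noteq> 2 * n" by presburger
      then show ?thesis unfolding inv\<phi> unfolding \<phi>_def \<alpha>_def \<beta>_def using that by (intro key) auto
    qed
    moreover have "gp \<one> (z \<otimes> \<phi> m) (\<phi> n) \<le> D1 + 2 * T" if "m < N" "n < N" "m \<noteq> n" "z \<in> Z" for m n z
      unfolding \<phi>_def \<alpha>_def \<beta>_def using that by (intro key) auto
    moreover have "gp \<one> (inv (\<phi> m)) (inv (\<phi> n)) \<le> D1 + 2 * T" if "m < N" "n < N" "m \<noteq> n" for m n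
    proof -
      have "gp \<one> (\<one> \<otimes> inv (\<phi> m)) (inv (\<phi> n)) \<le> D1 + 2 * T"
        unfolding inv\<phi> unfolding \<alpha>_def \<beta>_def using that Z(4) by (intro key) auto
      then show ?thesis using \<phi> by simp
    qed
    ultimately show ?thesis using \<phi> len pair
      unfolding spread_family_def by (intro exI[of _ \<phi>]) auto
  qed
  then show ?thesis by blast
qed

end
end

section \<open>Tilings\<close>

text \<open>
  Well-order the points and give each of them a colour that its predecessors among the
  neighbours do not have.
\<close>

lemma bounded_degree_coloring:
  fixes adj :: "'a \<Rightarrow> 'a \<Rightarrow> bool"
  assumes deg: "\<And>x. finite {y. adj x y} \<and> card {y. adj x y} \<le> N" and sym: "\<And>x y. adj x y \<Longrightarrow> adj y x"
  shows "\<exists>c::'a \<Rightarrow> nat. (\<forall>x. c x \<le> N) \<and> (\<forall>x y. adj x y \<longrightarrow> x \<noteq> y \<longrightarrow> c x \<noteq> c y)"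
proof -
  obtain r :: "'a rel" where r: "well_order_on UNIV r" using well_order_on by metis
  have wf: "wf (r - Id)" using r by (simp add: well_order_on_def)
  have "\<exists>c::'a \<Rightarrow> nat. \<forall>x. c x \<le> N \<and> (\<forall>y. (y, x) \<in> r - Id \<longrightarrow> adj x y \<longrightarrow> c x \<noteq> c y)"
  proof (rule dependent_wf_choice[OF wf, where
        P = "\<lambda>c x k. k \<le> N \<and> (\<forall>y. (y, x) \<in> r - Id \<longrightarrow> adj x y \<longrightarrow> k \<noteq> c y)"])
    fix x and f :: "'a \<Rightarrow> nat"
    have "card (f ` {y. adj x y}) < card {..N}"
      using card_image_le[of "{y. adj x y}" f] deg[of x] by simp
    then have "\<not> {..N} \<subseteq> f ` {y. adj x y}"
      using card_mono[of "f ` {y. adj x y}" "{..N}"] deg[of x] by auto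
    then show "\<exists>k. k \<le> N \<and> (\<forall>y. (y, x) \<in> r - Id \<longrightarrow> adj x y \<longrightarrow> k \<noteq> f y)" by auto
  qed auto
  then obtain c :: "'a \<Rightarrow> nat" where c: "\<And>x. c x \<le> N"
      "\<And>x y. (y, x) \<in> r - Id \<Longrightarrow> adj x y \<Longrightarrow> c x \<noteq> c y" by blast
  have "c x \<noteq> c y" if "adj x y" "x \<noteq> y" for x y
  proof -
    have "(x, y) \<in> r \<or> (y, x) \<in> r"
      using r that(2) by (simp add: well_order_on_def linear_order_on_def total_on_def)
    then show ?thesis using c(2)[of x y] c(2)[of y x] sym that by auto
  qed
  then show ?thesis using c(1) by blast
qed

text \<open>
  A point \<open>p\<close> gets its own translate \<open>t p <# F\<close> exactly if no translate belonging to a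
  point of smaller weight covers it. This is a recursion on the weight, and points of
  equal weight do not interfere, as \<open>p\<close> is the unique point of minimal weight in \<open>t p <# F\<close>.
\<close>

lemma greedy_tiling:
  fixes G (structure) and w :: "'a \<Rightarrow> nat"
  assumes F: "\<And>g. g \<in> carrier G \<Longrightarrow> g <# F \<subseteq> carrier G"
    and t: "\<And>p. p \<in> carrier G \<Longrightarrow> t p \<in> carrier G \<and> p \<in> t p <# F"
    and outward: "\<And>p q. \<lbrakk>p \<in> carrier G; q \<in> t p <# F; q \<noteq> p\<rbrakk> \<Longrightarrow> w p < w q"
    and separate: "\<And>p p' q. \<lbrakk>p \<in> carrier G; p' \<in> carrier G; q \<in> t p <# F; q \<in> t p' <# F;
      q \<noteq> p; q \<noteq> p'\<rbrakk> \<Longrightarrow> t p = t p'"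
  shows "\<exists>C \<subseteq> carrier G. disjoint_family_on (\<lambda>g. g <# F) C \<and> (\<Union>g\<in>C. g <# F) = carrier G"
proof -
  have "\<exists>u. \<forall>x. u x \<longleftrightarrow> \<not> (\<exists>y \<in> carrier G. (y, x) \<in> Wellfounded.measure w \<and> u y \<and> x \<in> t y <# F)"
    by (rule dependent_wf_choice[OF wf_measure[of w], where P = "\<lambda>u x b. b \<longleftrightarrow>
      \<not> (\<exists>y \<in> carrier G. (y, x) \<in> Wellfounded.measure w \<and> u y \<and> x \<in> t y <# F)"]) auto
  then obtain u where u: "\<And>x. u x \<longleftrightarrow> \<not> (\<exists>y \<in> carrier G. w y < w x \<and> u y \<and> x \<in> t y <# F)"
    by auto
  define C where "C = t ` {p \<in> carrier G. u p}"
  have first: "\<not> u q" if "p \<in> carrier G" "u p" "q \<in> t p <# F" "q \<noteq> p" for p q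
    using u[of q] that outward[of p q] by blast
  have "disjoint_family_on (\<lambda>g. g <# F) C"
    unfolding disjoint_family_on_def
  proof (intro ballI impI equals0I)
    fix g g' q assume "g \<in> C" "g' \<in> C" "g \<noteq> g'" "q \<in> (g <# F) \<inter> (g' <# F)"
    then obtain p p' where p: "p \<in> carrier G" "u p" "g = t p" "p' \<in> carrier G" "u p'" "g' = t p'"
        "q \<in> t p <# F" "q \<in> t p' <# F" "t p \<noteq> t p'" unfolding C_def by auto
    then show False using first[of p q] first[of p' q] separate[of p p' q] by blast
  qed
  moreover have "(\<Union>g\<in>C. g <# F) = carrier G"
  proof
    show "(\<Union>g\<in>C. g <# F) \<subseteq> carrier G" using t F by (auto simp: C_def)
    show "carrier G \<subseteq> (\<Union>g\<in>C. g <# F)"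
    proof
      fix x assume x: "x \<in> carrier G"
      show "x \<in> (\<Union>g\<in>C. g <# F)"
      proof (cases "u x")
        case True
        then show ?thesis using t[OF x] x by (auto simp: C_def)
      next
        case False
        then show ?thesis using u[of x] by (auto simp: C_def)
      qed
    qed
  qed
  ultimately show ?thesis using t by (intro exI[of _ C]) (auto simp: C_def)
qed

context hyperbolic_group begin

text \<open>
  If \<open>p = g f\<close> and \<open>f\<inverse>\<close> does not point from \<open>p\<close> back to \<open>\<one>\<close>, then from \<open>g\<close> the point \<open>\<one>\<close> is seen in
  the direction of \<open>f\<close>. Any \<open>x\<close> that diverges from \<open>f\<close> leads away from \<open>\<one>\<close>, and from \<open>g x\<close> the
  point \<open>\<one>\<close> is seen in the direction of \<open>x\<inverse>\<close>.
\<close>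

lemma tile_points_outward:
  assumes mem: "g \<in> carrier G" "f \<in> carrier G" "x \<in> carrier G"
    and tip: "gp \<one> (inv (g \<otimes> f)) (inv f) \<le> C1" and "gp \<one> x f \<le> D" and long: "C1 + D + \<delta> < d \<one> f"
  shows "d \<one> f - C1 \<le> gp \<one> (inv g) f"
    and "d \<one> (g \<otimes> f) + d \<one> f + d \<one> x - 2 * C1 - 2 * D - 2 * \<delta> \<le> d \<one> (g \<otimes> x)"
    and "d \<one> x - D - \<delta> \<le> gp \<one> (inv (g \<otimes> x)) (inv x)"
proof -
  have eqs: "gp \<one> (inv g) y = (d \<one> g + d \<one> y - d \<one> (g \<otimes> y)) / 2"
      "gp \<one> (inv (g \<otimes> y)) (inv y) = (d \<one> (g \<otimes> y) + d \<one> y - d \<one> g) / 2" if "y \<in> carrier G" for y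
  proof -
    have "d (inv g) y = d \<one> (g \<otimes> y)" using dist_eq_length[of "inv g" y] mem that by simp
    moreover have "d (inv (g \<otimes> y)) (inv y) = d \<one> g"
      using dist_eq_length[of "inv (g \<otimes> y)" "inv y"] mem that by (simp add: m_assoc)
    ultimately show "gp \<one> (inv g) y = (d \<one> g + d \<one> y - d \<one> (g \<otimes> y)) / 2"
      "gp \<one> (inv (g \<otimes> y)) (inv y) = (d \<one> (g \<otimes> y) + d \<one> y - d \<one> g) / 2"
      using mem that by (simp_all add: gromov_product_def length_inv)
  qed
  have f: "gp \<one> (inv g) f = d \<one> f - gp \<one> (inv (g \<otimes> f)) (inv f)"
    using eqs[OF mem(2)] by (simp add: field_simps)
  then show 1: "d \<one> f - C1 \<le> gp \<one> (inv g) f" using tip by simp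
  have x: "gp \<one> (inv g) x \<le> D + \<delta>"
    using four_point[of \<one> x "inv g" f] 1 assms mem by (auto simp: gp_commute)
  then show "d \<one> (g \<otimes> f) + d \<one> f + d \<one> x - 2 * C1 - 2 * D - 2 * \<delta> \<le> d \<one> (g \<otimes> x)"
    using tip eqs(2)[OF mem(2)] eqs(1)[OF mem(3)] by (simp add: field_simps)
  show "d \<one> x - D - \<delta> \<le> gp \<one> (inv (g \<otimes> x)) (inv x)"
    using x eqs[OF mem(3)] by (simp add: field_simps)
qed

text \<open>
  Here \<open>R\<close> bounds the lengths in \<open>K\<close>. The radius up to which \<open>col\<close> separates points bounds the
  distance of two shortest points with the same \<open>f\<close> whose translates \<open>g F\<close> and \<open>g' F\<close> overlap in \<open>g K \<inter> g' K\<close>.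
\<close>

lemma tile_from_independent_family:
  fixes \<phi> :: "nat \<Rightarrow> 'a" and col :: "'a \<Rightarrow> nat"
  assumes K: "finite K" "K \<subseteq> carrier G" "\<one> \<in> K" "\<And>x. x \<in> K \<Longrightarrow> d \<one> x \<le> R"
    and col: "\<And>x. col x \<le> N" "\<And>p p'. \<lbrakk>p \<in> carrier G; p' \<in> carrier G; p \<noteq> p';
        d p p' \<le> 2 * (C0 + \<delta>) + 6 * R + 2 * \<delta>\<rbrakk> \<Longrightarrow> col p \<noteq> col p'"
    and bounds: "R \<le> D" "C0 + \<delta> \<le> D" "0 \<le> C0"
    and fam: "spread_family C0 D L Z (2 * N + 2) \<phi>"
      "L = 4 * D + 4 * R + 4 * \<delta> + 1" "Z = (\<lambda>(x, y). x \<otimes> inv y) ` (K \<times> K)"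
  shows "tile G (K \<union> \<phi> ` {..<2 * N + 2})"
proof -
  have \<delta>: "0 \<le> \<delta>" using delta_nonneg[of \<one>] by simp
  have R: "0 \<le> R" using K(4)[OF K(3)] by simp
  have Z: "x \<otimes> inv y \<in> Z" if "x \<in> K" "y \<in> K" for x y using that fam(3) by auto
  have \<phi>: "\<phi> n \<in> carrier G" "n < 2 * N + 2 \<Longrightarrow> L \<le> d \<one> (\<phi> n)" for n
    using fam(1) by (auto simp: spread_family_def)
  have pair: "gp \<one> (inv (\<phi> (2 * c))) (inv (\<phi> (2 * c + 1))) \<le> C0" if "c \<le> N" for c
    using fam(1) that by (auto simp: spread_family_def)
  have H1: "gp \<one> (x \<otimes> inv y \<otimes> inv (\<phi> m)) (\<phi> n) \<le> D"
    if "m < 2 * N + 2" "n < 2 * N + 2" "x \<in> K" "y \<in> K" for m n x y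
    using fam(1) that(1,2) Z[OF that(3,4)] by (simp add: spread_family_def)
  have H2: "gp \<one> (x \<otimes> inv y \<otimes> \<phi> m) (\<phi> n) \<le> D"
    if "m < 2 * N + 2" "n < 2 * N + 2" "m \<noteq> n" "x \<in> K" "y \<in> K" for m n x y
    using fam(1) that(1-3) Z[OF that(4,5)] by (simp add: spread_family_def)
  have H3: "gp \<one> (inv (\<phi> m)) (inv (\<phi> n)) \<le> D" if "m < 2 * N + 2" "n < 2 * N + 2" "m \<noteq> n" for m n
    using fam(1) that by (simp add: spread_family_def)
  define C1 where "C1 = C0 + \<delta>"
  define F where "F = K \<union> \<phi> ` {..<2 * N + 2}"
  have FG: "F \<subseteq> carrier G" using K \<phi> by (auto simp: F_def)
  have "\<exists>e. e < 2 * N + 2 \<and> e div 2 = col p \<and> gp \<one> (inv p) (inv (\<phi> e)) \<le> C1"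
    if "p \<in> carrier G" for p
  proof -
    define c where "c = col p"
    have c: "c \<le> N" using col(1) by (simp add: c_def)
    have "gp \<one> (inv p) (inv (\<phi> (2 * c))) \<le> C1 \<or> gp \<one> (inv p) (inv (\<phi> (2 * c + 1))) \<le> C1"
      using four_point[of \<one> "inv (\<phi> (2 * c))" "inv p" "inv (\<phi> (2 * c + 1))"] pair[OF c] \<phi>(1) that
      by (auto simp: gp_commute C1_def)
    then show ?thesis using c unfolding c_def[symmetric]
      by (elim disjE) (intro exI[of _ "2 * c"], simp, intro exI[of _ "2 * c + 1"], simp)
  qed
  then obtain e where e: "\<And>p. p \<in> carrier G \<Longrightarrow> e p < 2 * N + 2"
      "\<And>p. p \<in> carrier G \<Longrightarrow> e p div 2 = col p"
      "\<And>p. p \<in> carrier G \<Longrightarrow> gp \<one> (inv p) (inv (\<phi> (e p))) \<le> C1" by metis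
  define t where "t p = p \<otimes> inv (\<phi> (e p))" for p
  have t: "t p \<in> carrier G" "t p \<otimes> \<phi> (e p) = p" if "p \<in> carrier G" for p
    using that \<phi>(1) by (simp_all add: t_def m_assoc)
  have tipF: "\<phi> (e p) \<in> F" if "p \<in> carrier G" for p using e(1)[OF that] by (auto simp: F_def)
  have length_tip: "L \<le> d \<one> (\<phi> (e p))" if "p \<in> carrier G" for p using \<phi>(2) e(1)[OF that] by simp
  have away: "gp \<one> x (\<phi> (e p)) \<le> D" if px: "p \<in> carrier G" "x \<in> F" "x \<noteq> \<phi> (e p)" for p x
  proof (cases "x \<in> K")
    case True
    then show ?thesis using gp_le[of \<one> x "\<phi> (e p)"] \<phi>(1) K(2,4) bounds(1) by fastforce
  next
    case False
    then obtain m where "x = \<phi> m" "m < 2 * N + 2" "m \<noteq> e p" using px by (auto simp: F_def)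
    then show ?thesis using H2[of m "e p" \<one> \<one>] e(1)[OF px(1)] K(3) \<phi>(1) by simp
  qed
  note bnds = bounds fam(2) C1_def R \<delta>
  have out: "d \<one> (\<phi> (e p)) - C1 \<le> gp \<one> (inv (t p)) (\<phi> (e p))"
      "d \<one> p + 1 \<le> d \<one> (t p \<otimes> x)" "d \<one> x - D - \<delta> \<le> gp \<one> (inv (t p \<otimes> x)) (inv x)"
    if p: "p \<in> carrier G" and x: "x \<in> F" "x \<noteq> \<phi> (e p)" for p x
  proof -
    have "x \<in> carrier G" using x FG by blast
    note T = tile_points_outward[of "t p" "\<phi> (e p)" x C1 D, OF t(1)[OF p] \<phi>(1) this _ away[OF p x]]
    have long: "C1 + D + \<delta> < d \<one> (\<phi> (e p))" "2 * C1 + 2 * D + 2 * \<delta> + 1 \<le> d \<one> (\<phi> (e p))"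
      using length_tip[OF p] bnds by linarith+
    show "d \<one> (\<phi> (e p)) - C1 \<le> gp \<one> (inv (t p)) (\<phi> (e p))"
      "d \<one> x - D - \<delta> \<le> gp \<one> (inv (t p \<otimes> x)) (inv x)"
      using T(1,3) t(2)[OF p] e(3)[OF p] long by auto
    have "d \<one> p + d \<one> (\<phi> (e p)) + d \<one> x - 2 * C1 - 2 * D - 2 * \<delta> \<le> d \<one> (t p \<otimes> x)"
      using T(2) t(2)[OF p] e(3)[OF p] long by simp
    then show "d \<one> p + 1 \<le> d \<one> (t p \<otimes> x)" using long nonneg[of \<one> x] by linarith
  qed
  \<comment> \<open>A tip of one translate in the part \<open>K\<close> of the other: then \<open>\<one>\<close> is seen from \<open>t p'\<close> both in the direction
    of \<open>\<phi> (e p')\<close> and in that of \<open>y (\<phi> m)\<inverse>\<close>.\<close>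
  have mixed: False
    if p: "p \<in> carrier G" "p' \<in> carrier G" and m: "m < 2 * N + 2" "\<phi> m \<noteq> \<phi> (e p)"
      and y: "y \<in> K" "y \<noteq> \<phi> (e p')" and q: "t p \<otimes> \<phi> m = t p' \<otimes> y" for p p' m y
  proof -
    have yG: "y \<in> carrier G" using y K by blast
    have "L - D - \<delta> \<le> gp \<one> (inv (t p' \<otimes> y)) (inv (\<phi> m))"
      using out(3)[OF p(1), of "\<phi> m"] m \<phi>(2)[of m] q by (auto simp: F_def)
    also have "\<dots> \<le> gp \<one> (inv (t p')) (y \<otimes> inv (\<phi> m)) + R"
      using gp_rebase[OF t(1)[OF p(2)] yG, of "inv (\<phi> m)"] \<phi>(1) K(4)[OF y(1)] by simp
    finally have 1: "L - D - \<delta> - R \<le> gp \<one> (inv (t p')) (y \<otimes> inv (\<phi> m))" by simp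
    have 2: "L - C1 \<le> gp \<one> (inv (t p')) (\<phi> (e p'))"
      using out(1)[OF p(2), of y] y length_tip[OF p(2)] by (auto simp: F_def)
    have "gp \<one> (y \<otimes> inv (\<phi> m)) (\<phi> (e p')) \<le> D"
      using H1[of m "e p'" y \<one>] m y(1) K(3) e(1)[OF p(2)] yG by simp
    then show False
      using four_point[of \<one> "y \<otimes> inv (\<phi> m)" "inv (t p')" "\<phi> (e p')"] 1 2 bnds yG \<phi>(1) t(1) p
      by (auto simp: gp_commute)
  qed
  have separate: "t p = t p'"
    if p: "p \<in> carrier G" "p' \<in> carrier G" and x: "x \<in> F" "x \<noteq> \<phi> (e p)"
      and y: "y \<in> F" "y \<noteq> \<phi> (e p')" and q: "t p \<otimes> x = t p' \<otimes> y" for p p' x y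
  proof -
    have xyG: "x \<in> carrier G" "y \<in> carrier G" using x y FG by auto
    consider (tips) m n where "x = \<phi> m" "y = \<phi> n" "m < 2 * N + 2" "n < 2 * N + 2"
      | (mix1) m where "x = \<phi> m" "m < 2 * N + 2" "y \<in> K"
      | (mix2) n where "y = \<phi> n" "n < 2 * N + 2" "x \<in> K"
      | (core) "x \<in> K" "y \<in> K" using x y by (auto simp: F_def)
    then show ?thesis
    proof cases
      case tips
      have "x = y"
      proof (rule ccontr)
        assume "x \<noteq> y"
        then have "gp \<one> (inv x) (inv y) \<le> D" using H3 tips by blast
        then show False
          using four_point[of \<one> "inv x" "inv (t p \<otimes> x)" "inv y"] out(3)[OF p(1) x] out(3)[OF p(2) y]
            q \<phi>(2)[OF tips(3)] \<phi>(2)[OF tips(4)] tips bnds xyG t(1)[OF p(1)] t(1)[OF p(2)] by (auto simp: gp_commute)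
      qed
      then show ?thesis using q xyG t(1) p by simp
    next
      case mix1
      then show ?thesis using mixed[OF p mix1(2) _ mix1(3) y(2)] x q by blast
    next
      case mix2
      then show ?thesis using mixed[OF p(2,1) mix2(2) _ mix2(3) x(2)] y q by metis
    next
      case core
      define z where "z = x \<otimes> inv y"
      have z: "z \<in> carrier G" using xyG by (simp add: z_def)
      have tz: "t p' = t p \<otimes> z" using q xyG t(1) p by (simp add: z_def m_assoc[symmetric] inv_solve_right)
      have lenz: "d \<one> z \<le> 2 * R"
        using length_mult_le[of x "inv y"] K(4)[OF core(1)] K(4)[OF core(2)] xyG by (simp add: z_def length_inv)
      define f f' where "f = \<phi> (e p)" and "f' = \<phi> (e p')"
      have ff: "f \<in> carrier G" "f' \<in> carrier G" using \<phi>(1) by (auto simp: f_def f'_def)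
      have 1: "d \<one> f - C1 \<le> gp \<one> (inv (t p)) f" using out(1)[OF p(1) x] by (simp add: f_def)
      have "d \<one> f' - C1 \<le> gp \<one> (inv (t p')) f'" using out(1)[OF p(2) y] by (simp add: f'_def)
      then have 2: "d \<one> f' - C1 - 2 * R \<le> gp \<one> (inv (t p)) (z \<otimes> f')"
        using gp_rebase[OF t(1)[OF p(1)] z ff(2)] tz lenz by simp
      note fp = four_point[of \<one> "z \<otimes> f'" "inv (t p)" f]
      have same: "e p = e p'"
      proof (rule ccontr)
        assume "e p \<noteq> e p'"
        then have "gp \<one> (z \<otimes> f') f \<le> D"
          using H2[of "e p'" "e p" x y] e(1) p core by (simp add: z_def f_def f'_def)
        then show False
          using fp 1 2 length_tip[OF p(1)] length_tip[OF p(2)] bnds z ff t(1)[OF p(1)]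
          by (auto simp: gp_commute f_def f'_def)
      qed
      then have ff': "f' = f" by (simp add: f_def f'_def)
      have "d \<one> f - C1 - 2 * R - \<delta> \<le> gp \<one> (z \<otimes> f) f"
        using fp 1 2 z ff t(1)[OF p(1)] R unfolding ff' by (auto simp: gp_commute min_def split: if_splits)
      moreover have "d p p' = d f (z \<otimes> f)"
        using left_invariant[of "t p" f "z \<otimes> f"] t p z ff tz same
        by (metis f_def m_assoc m_closed)
      moreover have "d \<one> (z \<otimes> f) \<le> d \<one> f + 2 * R" using length_mult_le[OF z ff(1)] lenz by simp
      ultimately have "d p p' \<le> 2 * C1 + 6 * R + 2 * \<delta>"
        by (simp add: gromov_product_def commute field_simps)
      moreover have "col p = col p'" using e(2) p same by metis
      ultimately have "p = p'" using col(2) p by (auto simp: C1_def)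
      then show ?thesis by simp
    qed
  qed
  have "\<exists>C \<subseteq> carrier G. disjoint_family_on (\<lambda>g. g <# F) C \<and> (\<Union>g\<in>C. g <# F) = carrier G"
  proof (rule greedy_tiling[where t = t and w = "\<lambda>p. nat \<lfloor>d \<one> p\<rfloor>"])
    show "g <# F \<subseteq> carrier G" if "g \<in> carrier G" for g
      using that FG by (auto simp: l_coset_def)
    show "t p \<in> carrier G \<and> p \<in> t p <# F" if "p \<in> carrier G" for p
      using t[OF that] tipF[OF that] by (auto simp: l_coset_def intro!: bexI[of _ "\<phi> (e p)"])
    show "nat \<lfloor>d \<one> p\<rfloor> < nat \<lfloor>d \<one> q\<rfloor>" if p: "p \<in> carrier G" and q: "q \<in> t p <# F" "q \<noteq> p" for p q
    proof -
      obtain x where x: "x \<in> F" "q = t p \<otimes> x" using q by (auto simp: l_coset_def)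
      then have "d \<one> p + 1 \<le> d \<one> q" using out(2)[OF p x(1)] t(2)[OF p] q by auto
      then have "\<lfloor>d \<one> p\<rfloor> < \<lfloor>d \<one> q\<rfloor>" by linarith
      moreover have "0 \<le> \<lfloor>d \<one> p\<rfloor>" by simp
      ultimately show ?thesis by linarith
    qed
    show "t p = t p'" if p: "p \<in> carrier G" "p' \<in> carrier G" and q: "q \<in> t p <# F" "q \<in> t p' <# F"
      "q \<noteq> p" "q \<noteq> p'" for p p' q
    proof -
      obtain x y where "x \<in> F" "y \<in> F" "q = t p \<otimes> x" "q = t p' \<otimes> y" using q by (auto simp: l_coset_def)
      then show ?thesis using separate[OF p, of x y] t(2) p q by metis
    qed
  qed
  moreover have "finite F" using K(1) by (simp add: F_def)
  moreover have "2 \<le> card F"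
  proof -
    have "0 < L" using bnds by linarith
    then have "\<phi> 0 \<noteq> \<one>" using \<phi>(2)[of 0] by auto
    then have "card {\<one>, \<phi> 0} = 2" by simp
    moreover have "{\<one>, \<phi> 0} \<subseteq> F" using K(3) by (auto simp: F_def)
    ultimately show ?thesis using card_mono[OF \<open>finite F\<close>] by metis
  qed
  ultimately show ?thesis using FG unfolding tile_def F_def by blast
qed

theorem property_P_if_not_virtually_cyclic:
  assumes "\<not> virtually_cyclic G"
  shows "property_P G"
  unfolding property_P_def
proof (intro allI impI)
  fix K0 assume K0: "finite K0 \<and> K0 \<subseteq> carrier G"
  have \<delta>: "0 \<le> \<delta>" using delta_nonneg[of \<one>] by simp
  have "infinite (carrier G)"
  proof
    assume fin: "finite (carrier G)"
    have "rcosets {\<one>} \<subseteq> Pow (carrier G)" by (auto simp: RCOSETS_def r_coset_def)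
    then have "finite (rcosets {\<one>})" using fin finite_subset by blast
    moreover have "subgroup {\<one>} G" by (rule triv_subgroup)
    moreover have "cyclic_group (G\<lparr>carrier := {\<one>}\<rparr>)"
      using \<open>subgroup {\<one>} G\<close> by (intro trivial_imp_cyclic_group) (auto simp: trivial_group_def subgroup_imp_group)
    ultimately show False using assms unfolding virtually_cyclic_def by blast
  qed
  then obtain h where h: "h \<in> carrier G" "2 * gp \<one> h (inv h) + 3 * \<delta> + 1 \<le> d \<one> h"
    using exists_translation by blast
  define C where "C = gp \<one> h (inv h) + 2 * \<delta>"
  have ax: "quasi_axis h C" using quasi_axisI[OF h] by (simp add: C_def)
  have "commensurator h \<noteq> carrier G"
    using commensurator_all_imp_virtually_cyclic[OF ax] assms by blast
  then obtain g where g: "g \<in> carrier G" "g \<notin> commensurator h"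
    using commensurator_mem[OF ax] by blast
  obtain B where B: "\<And>(m::int) (n::int). gp \<one> (g \<otimes> h [^] m) (h [^] n) \<le> B"
    using not_commensurator_bounded[OF ax g] by blast
  define K where "K = insert \<one> K0"
  have K: "finite K" "K \<subseteq> carrier G" "\<one> \<in> K" using K0 by (auto simp: K_def)
  have "\<exists>R. \<forall>x\<in>K. d \<one> x \<le> R" by (rule uniform_bound) (use K in auto)
  then obtain R where R: "\<And>x. x \<in> K \<Longrightarrow> d \<one> x \<le> R" by blast
  define C0 where "C0 = C + 2 * \<delta>"
  define r where "r = 2 * (C0 + \<delta>) + 6 * R + 2 * \<delta>"
  define ball where "ball = {x \<in> carrier G. d \<one> x \<le> r}"
  define N where "N = card ball"
  define adj where "adj x y \<longleftrightarrow> x \<in> carrier G \<and> y \<in> carrier G \<and> d x y \<le> r" for x y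
  have "finite {y. adj x y} \<and> card {y. adj x y} \<le> N" for x
  proof (cases "x \<in> carrier G")
    case True
    have "{y. adj x y} \<subseteq> (\<lambda>b. x \<otimes> b) ` ball"
    proof
      fix y assume "y \<in> {y. adj x y}"
      then have "y \<in> carrier G" "d x y \<le> r" by (auto simp: adj_def)
      then have "inv x \<otimes> y \<in> ball" "y = x \<otimes> (inv x \<otimes> y)"
        using True dist_eq_length[of x y] by (auto simp: ball_def m_assoc[symmetric])
      then show "y \<in> (\<lambda>b. x \<otimes> b) ` ball" by blast
    qed
    moreover have "finite ball" unfolding ball_def by (rule finite_balls)
    ultimately show ?thesis
      unfolding N_def using surj_card_le finite_subset by (metis finite_imageI)
  qed (simp add: adj_def)
  then obtain col :: "'a \<Rightarrow> nat" where col: "\<And>x. col x \<le> N" "\<And>x y. adj x y \<Longrightarrow> x \<noteq> y \<Longrightarrow> col x \<noteq> col y"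
    using bounded_degree_coloring[of adj N] by (auto simp: adj_def commute)
  define Z where "Z = (\<lambda>(x, y). x \<otimes> inv y) ` (K \<times> K)"
  have Z: "finite Z" "Z \<subseteq> carrier G" "\<one> \<in> Z" using K by (force simp: Z_def)+
  have Zinv: "inv z \<in> Z" if z: "z \<in> Z" for z
  proof -
    obtain x y where "x \<in> K" "y \<in> K" "z = x \<otimes> inv y" using z by (auto simp: Z_def)
    moreover from this have "inv z = y \<otimes> inv x" using K(2) by (simp add: inv_mult_group subset_iff)
    ultimately show ?thesis by (auto simp: Z_def)
  qed
  obtain D0 where D0: "\<And>L. \<exists>\<phi>. spread_family C0 D0 L Z (2 * N + 2) \<phi>"
    using independent_family[OF ax g B Z(1,2) Zinv Z(3), of "2 * N + 2"] unfolding C0_def by metis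
  define D where "D = max D0 (max R (C0 + \<delta>))"
  define L where "L = 4 * D + 4 * R + 4 * \<delta> + 1"
  obtain \<phi> where \<phi>: "spread_family C0 D L Z (2 * N + 2) \<phi>"
    using D0[of L] spread_family_mono[where E = D] by (metis D_def max.cobounded1)
  have "tile G (K \<union> \<phi> ` {..<2 * N + 2})"
  proof (rule tile_from_independent_family[OF K R col(1) _ _ _ _ \<phi> L_def Z_def])
    show "col p \<noteq> col p'" if "p \<in> carrier G" "p' \<in> carrier G" "p \<noteq> p'"
      "d p p' \<le> 2 * (C0 + \<delta>) + 6 * R + 2 * \<delta>" for p p'
      using col(2)[of p p'] that by (simp add: adj_def r_def)
    show "0 \<le> C0" using axis_nonneg[OF ax] \<delta> by (simp add: C0_def)
  qed (simp_all add: D_def)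
  then show "\<exists>F. tile G F \<and> K0 \<subseteq> F" unfolding K_def by blast
qed

end

theorem proposition3:
  fixes G :: "('a, 'b) monoid_scheme"
  assumes "group G"
    and "word_hyperbolic G"
    and "non_elementary G"
  shows "property_P G"
proof -
  obtain d \<delta> where "hyperbolic_group G d \<delta>"
    using group.word_hyperbolic_imp_hyperbolic_group[OF assms(1,2)] by blast
  then show ?thesis
    using assms(3) by (rule hyperbolic_group.property_P_if_not_virtually_cyclic)
qed

end
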